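(* There exist constants $c,C>0$, an integer $n_0$, and a family of pairs of non-isomorphic simple undirected graphs $(G_n,H_n)_{n\ge n_0}$, where for each $n$ the graphs $G_n$ and $H_n$ have a common vertex set $\{1,\dots,N_n\}$ with $N_n\le Cn$, such that the Sherali-Adams procedure applied to $\mathcal T_{G_n,H_n}$ and to $\mathcal Q_{G_n,H_n}$ needs $\Omega(n)$ iterations to converge to $\operatorname{conv}(\Psi_{G_n,H_n})=\emptyset$; that is, for every $n\ge n_0$, every $k\ge1$ with $\mathcal T^k_{G_n,H_n}=\emptyset$ satisfies $k\ge cn$, and every $k\ge 1$ with $\mathcal Q^k_{G_n,H_n}=\emptyset$ satisfies $k\ge cn$.
   Context: For graphs $G,H$ on a vertex set $V=\{1,\dots,N\}$: $E_G$ is the edge set of $G$, $A_G$ its adjacency matrix, $e$ the all-ones vector, and $\Psi_{G,H}$ is the set of permutation matrices $X$ representing isomorphisms $\psi$ from $G$ to $H$ ($X_{uv}=1$ iff $\psi(u)=v$). $$\mathcal T_{G,H}=\{X\in[0,1]^{N\times N}: A_GX=XA_H,\ Xe=X^Te=e\}.$$ $\mathcal Q_{G,H}$ is the set of $X\in[0,1]^{N\times N}$ with $Xe=X^Te=e$, $X_{u_1v_1}X_{u_2v_2}=0$ for all $\{u_1,u_2\}\in E_G,\{v_1,v_2\}\notin E_H$, and $X_{u_1v_1}X_{u_2v_2}=0$ for all $\{u_1,u_2\}\notin E_G$, $\{v_1,v_2\}\in E_H$ (here $u_1=u_2$ counts as $\{u_1,u_2\}\notin E_G$, and $v_1=v_2$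 as $\{v_1,v_2\}\notin E_H$). **Sherali-Adams relaxations.** For $P=\{x\in[0,1]^M: f_j(x)=0\ (1\le j\le s),\ g_j(x)\ge 0\ (1\le j\le t)\}$ with polynomials $f_j,g_j$, the $k$th Sherali-Adams relaxation $P^k$ is obtained as follows. Form the constraints $\prod_{i\in I}x_i\, f_j(x)=0$ for all $I\subseteq\{1,\dots,M\}$, $|I|\le k-1$ and all $j$; $\prod_{i\in I}x_i\prod_{i\in J\setminus I}(1-x_i)\,g_j(x)\ge0$ for all $I\subseteq J$, $|J|\le k-1$ and all $j$; and $\prod_{i\in I}x_i\prod_{i\in J\setminus I}(1-x_i)\ge 0$ for all $I\subseteq J$, $|J|\le k$. Expand, replace every $x_i^2$ by $x_i$ repeatedly until all monomials are square-free, and replace each monomial $\prod_{i\in I}x_i$ with $|I|\ge 1$ by a new variable $y_I$ (and the empty monomial by $1$). This gives a polyhedron $\hat P^k$ in $y$-space, and $P^k=\{x: x_i=y_{\{i\}}\ \forall i,\ y\in\hat P^k\}$. The $f_j$ are the row-sum and column-sum equations together with the entries of $A_GX-XA_H$ (for $\mathcal T_{G,H}$) or the quadratic equations (for $\mathcal Q_{G,H}$); there are no $g_j$. $\mathcal T^k_{G,H}$, $\mathcal Q^k_{G,H}$ denote the $k$th relaxations. *)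

theory Defs
  imports Complex_Main "HOL-Library.FuncSet" "HOL-Library.Poly_Mapping"
begin

section \<open>Graphs on the vertex set {1..N}\<close>

text \<open>A graph is represented by its edge set. As edges have exactly two elements, {u, u} is never
  an edge.\<close>

definition simple_graph :: "nat \<Rightarrow> nat set set \<Rightarrow> bool" where
  "simple_graph N E \<longleftrightarrow> (\<forall>e\<in>E. e \<subseteq> {1..N} \<and> card e = 2)"

definition adj :: "nat set set \<Rightarrow> nat \<Rightarrow> nat \<Rightarrow> real" where
  "adj E u v = (if {u, v} \<in> E then 1 else 0)"

definition graph_iso :: "nat \<Rightarrow> nat set set \<Rightarrow> nat set set \<Rightarrow> (nat \<Rightarrow> nat) \<Rightarrow> bool" where
  "graph_iso N E F \<psi> \<longleftrightarrow> bij_betw \<psi> {1..N} {1..N} \<and>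
     (\<forall>u\<in>{1..N}. \<forall>v\<in>{1..N}. {u, v} \<in> E \<longleftrightarrow> {\<psi> u, \<psi> v} \<in> F)"

definition isomorphic :: "nat \<Rightarrow> nat set set \<Rightarrow> nat set set \<Rightarrow> bool" where
  "isomorphic N E F \<longleftrightarrow> (\<exists>\<psi>. graph_iso N E F \<psi>)"

text \<open>Real matrices with rows and columns indexed by {1..N} are functions on the entries in
  {1..N} \<times> {1..N}, undefined elsewhere.\<close>

abbreviation entries :: "nat \<Rightarrow> (nat \<times> nat) set" where
  "entries N \<equiv> {1..N} \<times> {1..N}"

definition iso_matrices :: "nat \<Rightarrow> nat set set \<Rightarrow> nat set set \<Rightarrow> (nat \<times> nat \<Rightarrow> real) set" where
  "iso_matrices N E F =
     {restrict (\<lambda>(u, v). if \<psi> u = v then 1 else 0) (entries N) | \<psi>. graph_iso N E F \<psi>}"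

text \<open>Function types carry no vector space structure in the library, so the convex hull is
  written out for sets of real-valued functions.\<close>

definition conv :: "('v \<Rightarrow> real) set \<Rightarrow> ('v \<Rightarrow> real) set" where
  "conv S = {(\<lambda>i. \<Sum>x\<in>T. w x * x i) | T w.
     finite T \<and> T \<subseteq> S \<and> (\<forall>x\<in>T. 0 \<le> w x) \<and> (\<Sum>x\<in>T. w x) = 1}"

definition \<T> :: "nat \<Rightarrow> nat set set \<Rightarrow> nat set set \<Rightarrow> (nat \<times> nat \<Rightarrow> real) set" where
  "\<T> N E F = {X \<in> entries N \<rightarrow>\<^sub>E {0..1}.
     (\<forall>u\<in>{1..N}. \<forall>v\<in>{1..N}. (\<Sum>w=1..N. adj E u w * X (w, v)) = (\<Sum>w=1..N. X (u, w) * adj F w v)) \<and>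
     (\<forall>u\<in>{1..N}. (\<Sum>v=1..N. X (u, v)) = 1) \<and>
     (\<forall>v\<in>{1..N}. (\<Sum>u=1..N. X (u, v)) = 1)}"

definition \<Q> :: "nat \<Rightarrow> nat set set \<Rightarrow> nat set set \<Rightarrow> (nat \<times> nat \<Rightarrow> real) set" where
  "\<Q> N E F = {X \<in> entries N \<rightarrow>\<^sub>E {0..1}.
     (\<forall>u1\<in>{1..N}. \<forall>u2\<in>{1..N}. \<forall>v1\<in>{1..N}. \<forall>v2\<in>{1..N}.
        {u1, u2} \<in> E \<and> {v1, v2} \<notin> F \<or> {u1, u2} \<notin> E \<and> {v1, v2} \<in> F \<longrightarrow>
        X (u1, v1) * X (u2, v2) = 0) \<and>
     (\<forall>u\<in>{1..N}. (\<Sum>v=1..N. X (u, v)) = 1) \<and>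
     (\<forall>v\<in>{1..N}. (\<Sum>u=1..N. X (u, v)) = 1)}"

section \<open>Sherali-Adams relaxations\<close>

text \<open>A polynomial maps each monomial to its coefficient, and a monomial maps each variable to its
  exponent. The ring structure is the one of \<^theory>\<open>HOL-Library.Poly_Mapping\<close>.\<close>

type_synonym 'v polynomial = "('v \<Rightarrow>\<^sub>0 nat) \<Rightarrow>\<^sub>0 real"

definition var :: "'v \<Rightarrow> 'v polynomial" where
  "var i = Poly_Mapping.single (Poly_Mapping.single i 1) 1"

definition const :: "real \<Rightarrow> 'v polynomial" where
  "const c = Poly_Mapping.single 0 c"

definition poly_value :: "('v \<Rightarrow> real) \<Rightarrow> 'v polynomial \<Rightarrow> real" where
  "poly_value x p = (\<Sum>m\<in>Poly_Mapping.keys p. Poly_Mapping.lookup p m *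
     (\<Prod>i\<in>Poly_Mapping.keys m. x i ^ Poly_Mapping.lookup m i))"

definition solution_set :: "'v set \<Rightarrow> 'v polynomial set \<Rightarrow> 'v polynomial set \<Rightarrow> ('v \<Rightarrow> real) set" where
  "solution_set V fs gs =
     {x \<in> V \<rightarrow>\<^sub>E {0..1}. (\<forall>f\<in>fs. poly_value x f = 0) \<and> (\<forall>g\<in>gs. poly_value x g \<ge> 0)}"

text \<open>Reducing squares turns a monomial m into the square-free monomial over the support
  \<open>Poly_Mapping.keys m\<close>, which is then replaced by the variable y indexed by this support, or by 1
  if the support is empty.\<close>

definition linearize :: "('v set \<Rightarrow> real) \<Rightarrow> 'v polynomial \<Rightarrow> real" where
  "linearize y p = (\<Sum>m\<in>Poly_Mapping.keys p. Poly_Mapping.lookup p m *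
     (if Poly_Mapping.keys m = {} then 1 else y (Poly_Mapping.keys m)))"

text \<open>Only coordinates of y at nonempty subsets of V are constrained; the others are irrelevant.\<close>

definition SA_lifted ::
  "'v set \<Rightarrow> 'v polynomial set \<Rightarrow> 'v polynomial set \<Rightarrow> nat \<Rightarrow> ('v set \<Rightarrow> real) set" where
  "SA_lifted V fs gs k = {y.
     (\<forall>f\<in>fs. \<forall>I. I \<subseteq> V \<and> card I \<le> k - 1 \<longrightarrow>
        linearize y ((\<Prod>i\<in>I. var i) * f) = 0) \<and>
     (\<forall>g\<in>gs. \<forall>I J. I \<subseteq> J \<and> J \<subseteq> V \<and> card J \<le> k - 1 \<longrightarrow>
        linearize y ((\<Prod>i\<in>I. var i) * (\<Prod>i\<in>J - I. 1 - var i) * g) \<ge> 0) \<and>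
     (\<forall>I J. I \<subseteq> J \<and> J \<subseteq> V \<and> card J \<le> k \<longrightarrow>
        linearize y ((\<Prod>i\<in>I. var i) * (\<Prod>i\<in>J - I. 1 - var i)) \<ge> 0)}"

text \<open>The relaxation depends on the polynomials describing the solution set, not only on the set.
  It is meant for finite V and \<open>k \<ge> 1\<close>.\<close>

definition SA_relaxation ::
  "'v set \<Rightarrow> 'v polynomial set \<Rightarrow> 'v polynomial set \<Rightarrow> nat \<Rightarrow> ('v \<Rightarrow> real) set" where
  "SA_relaxation V fs gs k =
     {x \<in> extensional V. \<exists>y\<in>SA_lifted V fs gs k. \<forall>i\<in>V. x i = y {i}}"

section \<open>The two relaxations of graph isomorphism\<close>

definition stochastic_polys :: "nat \<Rightarrow> (nat \<times> nat) polynomial set" where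
  "stochastic_polys N =
     {(\<Sum>v=1..N. var (u, v)) - 1 | u. u \<in> {1..N}} \<union>
     {(\<Sum>u=1..N. var (u, v)) - 1 | v. v \<in> {1..N}}"

definition commutation_polys ::
  "nat \<Rightarrow> nat set set \<Rightarrow> nat set set \<Rightarrow> (nat \<times> nat) polynomial set" where
  "commutation_polys N E F =
     {(\<Sum>w=1..N. const (adj E u w) * var (w, v)) - (\<Sum>w=1..N. var (u, w) * const (adj F w v)) | u v.
        u \<in> {1..N} \<and> v \<in> {1..N}}"

definition quadratic_polys ::
  "nat \<Rightarrow> nat set set \<Rightarrow> nat set set \<Rightarrow> (nat \<times> nat) polynomial set" where
  "quadratic_polys N E F =
     {var (u1, v1) * var (u2, v2) | u1 u2 v1 v2.
        u1 \<in> {1..N} \<and> u2 \<in> {1..N} \<and> v1 \<in> {1..N} \<and> v2 \<in> {1..N} \<and>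
        ({u1, u2} \<in> E \<and> {v1, v2} \<notin> F \<or> {u1, u2} \<notin> E \<and> {v1, v2} \<in> F)}"

definition \<T>_SA :: "nat \<Rightarrow> nat set set \<Rightarrow> nat set set \<Rightarrow> nat \<Rightarrow> (nat \<times> nat \<Rightarrow> real) set" where
  "\<T>_SA N E F k = SA_relaxation (entries N) (stochastic_polys N \<union> commutation_polys N E F) {} k"

definition \<Q>_SA :: "nat \<Rightarrow> nat set set \<Rightarrow> nat set set \<Rightarrow> nat \<Rightarrow> (nat \<times> nat \<Rightarrow> real) set" where
  "\<Q>_SA N E F k = SA_relaxation (entries N) (stochastic_polys N \<union> quadratic_polys N E F) {} k"

section \<open>The polynomial systems describe the sets \<open>\<T>\<close> and \<open>\<Q>\<close>\<close>

lemma poly_value_superset: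
  assumes "finite S" "Poly_Mapping.keys p \<subseteq> S"
  shows "poly_value x p = (\<Sum>m\<in>S. Poly_Mapping.lookup p m *
     (\<Prod>i\<in>Poly_Mapping.keys m. x i ^ Poly_Mapping.lookup m i))"
  unfolding poly_value_def using assms
  by (intro sum.mono_neutral_left) (auto simp: in_keys_iff)

lemma poly_value_diff: "poly_value x (p - q) = poly_value x p - poly_value x q"
proof -
  let ?S = "Poly_Mapping.keys p \<union> Poly_Mapping.keys q"
  have "Poly_Mapping.keys (p - q) \<subseteq> ?S" by (auto simp: in_keys_iff lookup_minus)
  then show ?thesis
    by (simp add: poly_value_superset[of ?S] lookup_minus left_diff_distrib sum_subtractf)
qed

lemma poly_value_add: "poly_value x (p + q) = poly_value x p + poly_value x q"
proof -
  let ?S = "Poly_Mapping.keys p \<union> Poly_Mapping.keys q"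
  have "Poly_Mapping.keys (p + q) \<subseteq> ?S" by (auto simp: in_keys_iff lookup_add)
  then show ?thesis
    by (simp add: poly_value_superset[of ?S] lookup_add distrib_right sum.distrib)
qed

lemma poly_value_zero [simp]: "poly_value x 0 = 0"
  by (simp add: poly_value_def)

lemma poly_value_sum: "poly_value x (\<Sum>a\<in>A. p a) = (\<Sum>a\<in>A. poly_value x (p a))"
  by (induction A rule: infinite_finite_induct) (simp_all add: poly_value_add)

lemma poly_value_one [simp]: "poly_value x 1 = 1"
  by (simp add: poly_value_def)

lemma poly_value_var [simp]: "poly_value x (var i) = x i"
  by (simp add: poly_value_def var_def)

lemma poly_value_const_var [simp]:
  "poly_value x (const c * var i) = c * x i"
  "poly_value x (var i * const c) = x i * c"
  by (simp_all add: poly_value_def var_def const_def mult_single)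

lemma poly_value_var_var:
  assumes "i \<noteq> j"
  shows "poly_value x (var i * var j) = x i * x j"
proof -
  have "Poly_Mapping.keys (Poly_Mapping.single i (1::nat) + Poly_Mapping.single j 1) = {i, j}"
    by (auto simp: in_keys_iff lookup_add lookup_single when_def split: if_splits)
  then show ?thesis
    using assms by (simp add: poly_value_def var_def mult_single lookup_add lookup_single)
qed

lemmas poly_value_simps = poly_value_diff poly_value_sum

lemma solution_set_Un:
  "x \<in> solution_set V (A \<union> B) {} \<longleftrightarrow>
     x \<in> V \<rightarrow>\<^sub>E {0..1} \<and> (\<forall>f\<in>A. poly_value x f = 0) \<and> (\<forall>f\<in>B. poly_value x f = 0)"
  by (auto simp: solution_set_def)

lemma stochastic_polys_iff:
  "(\<forall>f\<in>stochastic_polys N. poly_value X f = 0) \<longleftrightarrow>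
     (\<forall>u\<in>{1..N}. (\<Sum>v=1..N. X (u, v)) = 1) \<and> (\<forall>v\<in>{1..N}. (\<Sum>u=1..N. X (u, v)) = 1)"
  by (simp add: stochastic_polys_def ball_Un setcompr_eq_image poly_value_simps
      del: atLeastAtMost_iff)

lemma commutation_polys_iff:
  "(\<forall>f\<in>commutation_polys N E F. poly_value X f = 0) \<longleftrightarrow>
     (\<forall>u\<in>{1..N}. \<forall>v\<in>{1..N}.
        (\<Sum>w=1..N. adj E u w * X (w, v)) = (\<Sum>w=1..N. X (u, w) * adj F w v))"
proof -
  have "poly_value X ((\<Sum>w=1..N. const (adj E u w) * var (w, v)) -
      (\<Sum>w=1..N. var (u, w) * const (adj F w v))) = 0 \<longleftrightarrow>
      (\<Sum>w=1..N. adj E u w * X (w, v)) = (\<Sum>w=1..N. X (u, w) * adj F w v)" for u v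
    by (simp add: poly_value_simps)
  then show ?thesis
    unfolding commutation_polys_def by blast
qed

lemma quadratic_polys_iff:
  assumes "simple_graph N E" "simple_graph N F"
  shows "(\<forall>f\<in>quadratic_polys N E F. poly_value X f = 0) \<longleftrightarrow>
     (\<forall>u1\<in>{1..N}. \<forall>u2\<in>{1..N}. \<forall>v1\<in>{1..N}. \<forall>v2\<in>{1..N}.
        {u1, u2} \<in> E \<and> {v1, v2} \<notin> F \<or> {u1, u2} \<notin> E \<and> {v1, v2} \<in> F \<longrightarrow>
        X (u1, v1) * X (u2, v2) = 0)"
proof -
  have loop: "{u} \<notin> E" "{u} \<notin> F" for u
    using assms by (auto simp: simple_graph_def)
  have "poly_value X (var (u1, v1) * var (u2, v2)) = X (u1, v1) * X (u2, v2)"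
    if "{u1, u2} \<in> E \<and> {v1, v2} \<notin> F \<or> {u1, u2} \<notin> E \<and> {v1, v2} \<in> F" for u1 u2 v1 v2
    using that loop by (intro poly_value_var_var) auto
  then show ?thesis
    unfolding quadratic_polys_def by (smt (verit) mem_Collect_eq)
qed

lemma \<T>_eq_solution_set:
  "\<T> N E F = solution_set (entries N) (stochastic_polys N \<union> commutation_polys N E F) {}"
  unfolding \<T>_def set_eq_iff solution_set_Un stochastic_polys_iff commutation_polys_iff by blast

lemma \<Q>_eq_solution_set:
  assumes "simple_graph N E" "simple_graph N F"
  shows "\<Q> N E F = solution_set (entries N) (stochastic_polys N \<union> quadratic_polys N E F) {}"
  unfolding \<Q>_def set_eq_iff solution_set_Un stochastic_polys_iff quadratic_polys_iff[OF assms]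
  by blast

end

theory Submission
  imports Defs
begin

text \<open>The graphs are Cai-Fuerer-Immerman graphs over a bounded-degree base graph in which any two
  disjoint sets of a quarter of the vertices are joined by an edge; H differs from G by a parity
  flip at one base vertex z. A set F of base edges shifts the gadgets, and if the vertices of odd
  degree in F are exactly z and r, this shift is a bijection from G to H that preserves adjacency
  away from the gadget at r. The handshake lemma forbids a global isomorphism. Deleting a set W of
  at most a quarter of the base vertices leaves a component S(W) with more than half of them, and
  moving the defect r inside S(W) along a path does not affect the gadgets over W. So the frequency
  with which a random shift with defect r in S(W) realizes a small set I of assignments over W does
  not depend on r, and these frequencies solve the Sherali-Adams system.\<close>

section \<open>Solving the Sherali-Adams constraints\<close>

lemma linearize_superset:
  assumes "finite S" "Poly_Mapping.keys p \<subseteq> S" "y {} = 1"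
  shows "linearize y p = (\<Sum>m\<in>S. Poly_Mapping.lookup p m * y (Poly_Mapping.keys m))"
  unfolding linearize_def using assms
  by (intro sum.mono_neutral_cong_left) (auto simp: in_keys_iff)

lemma linearize_add:
  assumes "y {} = 1"
  shows "linearize y (p + q) = linearize y p + linearize y q"
proof -
  let ?S = "Poly_Mapping.keys p \<union> Poly_Mapping.keys q"
  have "Poly_Mapping.keys (p + q) \<subseteq> ?S" by (auto simp: in_keys_iff lookup_add)
  then show ?thesis
    by (simp add: linearize_superset[of ?S] assms lookup_add distrib_right sum.distrib)
qed

lemma linearize_diff:
  assumes "y {} = 1"
  shows "linearize y (p - q) = linearize y p - linearize y q"
  using linearize_add[of y "p - q" q] assms by simp

lemma linearize_sum:
  assumes "y {} = 1"
  shows "linearize y (\<Sum>a\<in>A. p a) = (\<Sum>a\<in>A. linearize y (p a))"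
  by (induction A rule: infinite_finite_induct)
    (simp_all add: linearize_add assms, simp_all add: linearize_def)

lemma linearize_single:
  assumes "y {} = 1"
  shows "linearize y (Poly_Mapping.single m c) = c * y (Poly_Mapping.keys m)"
  using assms by (subst linearize_superset[of "{m}"]) auto

lemma keys_add_nat:
  fixes m m' :: "'v \<Rightarrow>\<^sub>0 nat"
  shows "Poly_Mapping.keys (m + m') = Poly_Mapping.keys m \<union> Poly_Mapping.keys m'"
  by (auto simp: in_keys_iff lookup_add)

lemma prod_var_eq_single:
  assumes "finite I"
  shows "\<exists>m. (\<Prod>i\<in>I. var i) = Poly_Mapping.single m 1 \<and> Poly_Mapping.keys m = I"
  using assms
proof (induction I)
  case empty
  show ?case by (intro exI[of _ 0]) simp
next
  case (insert i I)
  then obtain m where m: "(\<Prod>i\<in>I. var i) = Poly_Mapping.single m 1" "Poly_Mapping.keys m = I"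
    by blast
  show ?case
    by (intro exI[of _ "Poly_Mapping.single i 1 + m"])
      (simp add: insert.hyps m(1), simp add: var_def mult_single keys_add_nat m(2))
qed

section \<open>Product constraints derived from row sums\<close>

context
  fixes N k :: nat and y :: "(nat \<times> nat) set \<Rightarrow> real"
  assumes y_empty: "y {} = 1"
    and y_nonneg: "\<And>I. y I \<ge> 0"
    and row: "\<And>I u. I \<subseteq> entries N \<Longrightarrow> card I \<le> k \<Longrightarrow> u \<in> {1..N} \<Longrightarrow>
      (\<Sum>v=1..N. y (insert (u, v) I)) = y I"
begin

text \<open>Expanding a factor \<open>1 - var j\<close> leaves a product without it, minus one with
  \<open>j\<close> moved into the monomial. Neither raises the number of variables in the monomial
  and \<open>K\<close> together, so the induction ends at a row equation of level
  \<open>k\<close>.\<close>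

lemma linearize_row:
  assumes "finite K" "K \<subseteq> entries N" "Poly_Mapping.keys m \<subseteq> entries N"
    "card (Poly_Mapping.keys m) + card K \<le> k" "u \<in> {1..N}"
  shows "linearize y (Poly_Mapping.single m 1 * (\<Prod>i\<in>K. 1 - var i) * ((\<Sum>v=1..N. var (u, v)) - 1)) = 0"
  using assms
proof (induction K arbitrary: m)
  case empty
  have *: "Poly_Mapping.single m 1 * ((\<Sum>v=1..N. var (u, v)) - 1) =
      (\<Sum>v=1..N. Poly_Mapping.single (m + Poly_Mapping.single (u, v) 1) 1) - Poly_Mapping.single m (1::real)"
    by (simp add: right_diff_distrib sum_distrib_left var_def mult_single)
  show ?case
    using row[of "Poly_Mapping.keys m" u] empty unfolding prod.empty mult_1_right *
    by (simp add: linearize_diff linearize_sum linearize_single y_empty keys_add_nat)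
next
  case (insert j K)
  let ?s = "(\<Sum>v=1..N. var (u, v)) - 1 :: (nat \<times> nat) polynomial"
  let ?P = "\<Prod>i\<in>K. 1 - var i :: (nat \<times> nat) polynomial"
  let ?m = "m + Poly_Mapping.single j 1"
  have *: "Poly_Mapping.single m 1 * (\<Prod>i\<in>insert j K. 1 - var i) * ?s =
     Poly_Mapping.single m 1 * ?P * ?s - Poly_Mapping.single ?m 1 * ?P * ?s"
  proof -
    have "Poly_Mapping.single ?m 1 = Poly_Mapping.single m (1::real) * var j"
      by (simp add: var_def mult_single)
    then show ?thesis using insert.hyps by (simp add: algebra_simps)
  qed
  have "card (Poly_Mapping.keys ?m) \<le> card (Poly_Mapping.keys m) + 1"
    by (simp add: keys_add_nat card_insert_if)
  then show ?case
    unfolding * using insert by (simp add: linearize_diff y_empty keys_add_nat)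
qed

text \<open>Modulo the row equations, 1 minus the variable at (u, v) is the sum of the other variables
  in row u, so these products become nonnegative combinations of values of y.\<close>

lemma linearize_nonneg:
  assumes "finite K" "K \<subseteq> entries N" "Poly_Mapping.keys m \<subseteq> entries N"
    "card (Poly_Mapping.keys m) + card K \<le> Suc k"
  shows "linearize y (Poly_Mapping.single m 1 * (\<Prod>i\<in>K. 1 - var i)) \<ge> 0"
  using assms
proof (induction K arbitrary: m)
  case empty
  then show ?case by (simp add: linearize_single y_empty y_nonneg)
next
  case (insert j K)
  obtain u v where j: "j = (u, v)" "u \<in> {1..N}" "v \<in> {1..N}" using insert.prems by auto
  let ?P = "\<Prod>i\<in>K. 1 - var i :: (nat \<times> nat) polynomial"
  let ?Q = "\<lambda>w. Poly_Mapping.single (m + Poly_Mapping.single (u, w) 1) 1 * ?P"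
  have "(\<Sum>w=1..N. var (u, w) :: (nat \<times> nat) polynomial) = var j + (\<Sum>w\<in>{1..N}-{v}. var (u, w))"
    using j by (subst sum.remove[of _ v]) auto
  then have "Poly_Mapping.single m (1::real) * (\<Prod>i\<in>insert j K. 1 - var i) =
     Poly_Mapping.single m 1 * ?P * (\<Sum>w\<in>{1..N}-{v}. var (u, w)) -
     Poly_Mapping.single m 1 * ?P * ((\<Sum>v=1..N. var (u, v)) - 1)"
    using insert.hyps by (simp add: algebra_simps)
  moreover have "Poly_Mapping.single m (1::real) * ?P * (\<Sum>w\<in>{1..N}-{v}. var (u, w)) =
     (\<Sum>w\<in>{1..N}-{v}. ?Q w)"
  proof -
    have "Poly_Mapping.single (m + Poly_Mapping.single (u, w) 1) 1 = Poly_Mapping.single m (1::real) * var (u, w)" for w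
      by (simp add: var_def mult_single)
    then show ?thesis by (simp add: sum_distrib_left mult_ac)
  qed
  \<comment> \<open>Taking \<open>j\<close> out leaves at most \<open>k\<close> variables, so the
    row equations reach one level further than their own bound.\<close>
  moreover have "linearize y (Poly_Mapping.single m 1 * ?P * ((\<Sum>v=1..N. var (u, v)) - 1)) = 0"
    using insert j by (intro linearize_row) auto
  ultimately have "linearize y (Poly_Mapping.single m 1 * (\<Prod>i\<in>insert j K. 1 - var i)) =
     (\<Sum>w\<in>{1..N}-{v}. linearize y (?Q w))"
    by (simp add: linearize_diff linearize_sum y_empty)
  also have "\<dots> \<ge> 0"
  proof (intro sum_nonneg insert.IH)
    fix w assume w: "w \<in> {1..N} - {v}"
    show "Poly_Mapping.keys (m + Poly_Mapping.single (u, w) 1) \<subseteq> entries N"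
      using insert.prems w j by (simp add: keys_add_nat)
    have "card (Poly_Mapping.keys (m + Poly_Mapping.single (u, w) 1)) \<le> card (Poly_Mapping.keys m) + 1"
      by (simp add: keys_add_nat card_insert_if)
    then show "card (Poly_Mapping.keys (m + Poly_Mapping.single (u, w) 1)) + card K \<le> Suc k"
      using insert by simp
  qed (use insert in auto)
  finally show ?case .
qed

text \<open>The vector \<open>y\<close> itself is the lifted point. Its product constraints follow
  from \<open>linearize_nonneg\<close> with \<open>K = J - I\<close>, so only the equations are left
  as a hypothesis.\<close>

lemma SA_relaxation_nonempty:
  assumes "\<And>f m. f \<in> fs \<Longrightarrow> Poly_Mapping.keys m \<subseteq> entries N \<Longrightarrow> card (Poly_Mapping.keys m) < k \<Longrightarrow>
      linearize y (Poly_Mapping.single m 1 * f) = 0" "k \<ge> 1"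
  shows "SA_relaxation (entries N) fs {} k \<noteq> {}"
proof -
  have "y \<in> SA_lifted (entries N) fs {} k"
    unfolding SA_lifted_def
  proof (intro CollectI conjI ballI allI impI)
    fix f I assume f: "f \<in> fs" and I: "I \<subseteq> entries N \<and> card I \<le> k - 1"
    then have "finite I" using finite_subset by blast
    then obtain m where "(\<Prod>i\<in>I. var i) = Poly_Mapping.single m 1" "Poly_Mapping.keys m = I"
      using prod_var_eq_single by blast
    moreover have "card I < k" using I \<open>k \<ge> 1\<close> by linarith
    ultimately show "linearize y ((\<Prod>i\<in>I. var i) * f) = 0"
      using assms(1)[OF f, of m] I       by metis
  next
    fix I J assume IJ: "I \<subseteq> J \<and> J \<subseteq> entries N \<and> card J \<le> k"
    have "finite J" using IJ by (intro finite_subset[of J "entries N"]) auto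
    then have fin: "finite J" "finite I" using IJ by (auto intro: finite_subset)
    obtain m where m: "(\<Prod>i\<in>I. var i) = Poly_Mapping.single m 1" "Poly_Mapping.keys m = I"
      using prod_var_eq_single[OF fin(2)] by blast
    have "card I + card (J - I) = card J"
      using fin IJ by (simp add: card_Diff_subset card_mono)
    with IJ have "card (Poly_Mapping.keys m) + card (J - I) \<le> Suc k" unfolding m(2) by linarith
    moreover have "Poly_Mapping.keys m \<subseteq> entries N" using IJ m(2) by blast
    ultimately show "linearize y ((\<Prod>i\<in>I. var i) * (\<Prod>i\<in>J - I. 1 - var i)) \<ge> 0"
      unfolding m(1) using fin IJ by (intro linearize_nonneg) auto
  qed simp
  then have "restrict (\<lambda>i. y {i}) (entries N) \<in> SA_relaxation (entries N) fs {} k"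
    unfolding SA_relaxation_def by auto
  then show ?thesis by blast
qed

section \<open>Equations derived from column sums and partial isomorphisms\<close>

context
  assumes col: "\<And>I v. I \<subseteq> entries N \<Longrightarrow> card I \<le> k \<Longrightarrow> v \<in> {1..N} \<Longrightarrow>
      (\<Sum>u=1..N. y (insert (u, v) I)) = y I"
begin

lemma linearize_stochastic:
  assumes "f \<in> stochastic_polys N" "Poly_Mapping.keys m \<subseteq> entries N" "card (Poly_Mapping.keys m) \<le> k"
  shows "linearize y (Poly_Mapping.single m 1 * f) = 0"
proof -
  have "Poly_Mapping.single m 1 * ((\<Sum>i\<in>S. var (g i)) - 1) =
      (\<Sum>i\<in>S. Poly_Mapping.single (m + Poly_Mapping.single (g i) 1) 1) - Poly_Mapping.single m (1::real)"
    for g :: "nat \<Rightarrow> nat \<times> nat" and S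
    by (simp add: right_diff_distrib sum_distrib_left var_def mult_single)
  then have *: "linearize y (Poly_Mapping.single m 1 * ((\<Sum>i\<in>S. var (g i)) - 1)) =
      (\<Sum>i\<in>S. y (insert (g i) (Poly_Mapping.keys m))) - y (Poly_Mapping.keys m)"
    for g :: "nat \<Rightarrow> nat \<times> nat" and S
    by (simp add: linearize_diff linearize_sum linearize_single y_empty keys_add_nat)
  show ?thesis
    using assms row col unfolding stochastic_polys_def by (auto simp: *)
qed

context
  fixes E F :: "nat set set"
  assumes partial_iso: "\<And>I u1 v1 u2 v2. I \<subseteq> entries N \<Longrightarrow> card I \<le> Suc k \<Longrightarrow>
      (u1, v1) \<in> I \<Longrightarrow> (u2, v2) \<in> I \<Longrightarrow> {u1, u2} \<in> E \<longleftrightarrow> {v1, v2} \<notin> F \<Longrightarrow> y I = 0"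
begin

text \<open>A quadratic equation enlarges a support of fewer than \<open>k\<close> entries by at
  most two, which is why \<open>partial_iso\<close> has to reach size \<open>Suc k\<close>.\<close>

lemma linearize_quadratic:
  assumes "f \<in> quadratic_polys N E F" "Poly_Mapping.keys m \<subseteq> entries N" "card (Poly_Mapping.keys m) < k"
  shows "linearize y (Poly_Mapping.single m 1 * f) = 0"
proof -
  obtain u1 v1 u2 v2 where f: "f = var (u1, v1) * var (u2, v2)"
    and u: "(u1, v1) \<in> entries N" "(u2, v2) \<in> entries N" "{u1, u2} \<in> E \<longleftrightarrow> {v1, v2} \<notin> F"
    using assms(1) unfolding quadratic_polys_def by auto
  let ?I = "insert (u1, v1) (insert (u2, v2) (Poly_Mapping.keys m))"
  have "linearize y (Poly_Mapping.single m 1 * f) = y ?I"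
    by (simp add: f var_def mult_single linearize_single y_empty keys_add_nat insert_commute)
  also have "card ?I \<le> Suc k"
    using assms(3) by (simp add: card_insert_if)
  then have "y ?I = 0"
    using u assms(2) by (intro partial_iso[of ?I u1 v1 u2 v2]) auto
  finally show ?thesis .
qed

text \<open>Multiplying each side by a further row or column sum turns it into the sum over (w, v) and
  (u, z), where only partial isomorphisms contribute and the two adjacency coefficients agree.\<close>

lemma linearize_commutation:
  assumes "f \<in> commutation_polys N E F" "Poly_Mapping.keys m \<subseteq> entries N" "card (Poly_Mapping.keys m) < k"
  shows "linearize y (Poly_Mapping.single m 1 * f) = 0"
proof -
  obtain u v where uv: "u \<in> {1..N}" "v \<in> {1..N}" and
    f: "f = (\<Sum>w=1..N. const (adj E u w) * var (w, v)) - (\<Sum>w=1..N. var (u, w) * const (adj F w v))"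
    using assms(1) unfolding commutation_polys_def by auto
  define I where "I = Poly_Mapping.keys m"
  have I: "I \<subseteq> entries N" "card I < k" "finite I" using assms by (auto simp: I_def)
  have "Poly_Mapping.single m 1 * f =
      (\<Sum>w=1..N. Poly_Mapping.single (m + Poly_Mapping.single (w, v) 1) (adj E u w)) -
      (\<Sum>w=1..N. Poly_Mapping.single (m + Poly_Mapping.single (u, w) 1) (adj F w v))"
    by (simp add: f right_diff_distrib sum_distrib_left var_def const_def mult_single)
  then have "linearize y (Poly_Mapping.single m 1 * f) =
      (\<Sum>w=1..N. adj E u w * y (insert (w, v) I)) - (\<Sum>z=1..N. adj F z v * y (insert (u, z) I))"
    by (simp add: linearize_diff linearize_sum linearize_single y_empty keys_add_nat I_def)
  also have "(\<Sum>w=1..N. adj E u w * y (insert (w, v) I)) =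
      (\<Sum>w=1..N. \<Sum>z=1..N. adj E u w * y (insert (u, z) (insert (w, v) I)))"
  proof (intro sum.cong refl)
    fix w assume "w \<in> {1..N}"
    then have "(\<Sum>z=1..N. y (insert (u, z) (insert (w, v) I))) = y (insert (w, v) I)"
      using I uv by (intro row) (auto simp: card_insert_if)
    then show "adj E u w * y (insert (w, v) I) =
        (\<Sum>z=1..N. adj E u w * y (insert (u, z) (insert (w, v) I)))"
      by (simp flip: sum_distrib_left)
  qed
  also have "\<dots> = (\<Sum>w=1..N. \<Sum>z=1..N. adj F z v * y (insert (w, v) (insert (u, z) I)))"
  proof (intro sum.cong refl)
    fix w z assume wz: "w \<in> {1..N}" "z \<in> {1..N}"
    let ?J = "insert (u, z) (insert (w, v) I)"
    have "card ?J \<le> Suc k" using I by (simp add: card_insert_if)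
    then have "y ?J = 0" if "{u, w} \<in> E \<longleftrightarrow> {z, v} \<notin> F"
      using that wz uv I by (intro partial_iso[of ?J u z w v]) auto
    then show "adj E u w * y ?J = adj F z v * y (insert (w, v) (insert (u, z) I))"
      by (auto simp: adj_def insert_commute)
  qed
  also have "\<dots> = (\<Sum>z=1..N. \<Sum>w=1..N. adj F z v * y (insert (w, v) (insert (u, z) I)))"
    by (rule sum.swap)
  also have "\<dots> = (\<Sum>z=1..N. adj F z v * y (insert (u, z) I))"
  proof (intro sum.cong refl)
    fix z assume "z \<in> {1..N}"
    then have "(\<Sum>w=1..N. y (insert (w, v) (insert (u, z) I))) = y (insert (u, z) I)"
      using I uv by (intro col) (auto simp: card_insert_if)
    then show "(\<Sum>w=1..N. adj F z v * y (insert (w, v) (insert (u, z) I))) = adj F z v * y (insert (u, z) I)"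
      by (simp flip: sum_distrib_left)
  qed
  finally show ?thesis by simp
qed

text \<open>One \<open>y\<close> serves both relaxations. What remains is to find consistent weights
  on sets of assignments that vanish off the partial isomorphisms.\<close>

lemma SA_nonempty:
  assumes "k \<ge> 1"
  shows "\<T>_SA N E F k \<noteq> {}" "\<Q>_SA N E F k \<noteq> {}"
  unfolding \<T>_SA_def \<Q>_SA_def
  by (rule SA_relaxation_nonempty;
      use linearize_stochastic linearize_commutation linearize_quadratic assms in
        \<open>force intro: less_imp_le\<close>)+

end
end
end

section \<open>The base graph\<close>

text \<open>Double counting: some pair (x, y) lies in A \<times> B for at least 1/64 of the pairs (A, B) not yet
  joined, so adding the edge {x, y} shrinks their number by the factor 63/64.\<close>

lemma greedy_edges:
  fixes V :: "'a set" and P :: "('a set \<times> 'a set) set"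
  assumes "finite V" "V \<noteq> {}" "finite P"
    and P: "\<And>A B. (A, B) \<in> P \<Longrightarrow> A \<subseteq> V \<and> B \<subseteq> V \<and> A \<inter> B = {} \<and> card V \<le> 8 * card A \<and> card V \<le> 8 * card B"
  shows "\<exists>E. (\<forall>e\<in>E. e \<subseteq> V \<and> card e = 2) \<and> finite E \<and> card E \<le> t \<and>
     real (card {(A, B) \<in> P. \<forall>x\<in>A. \<forall>y\<in>B. {x, y} \<notin> E}) \<le> (63 / 64) ^ t * card P"
proof (induction t)
  case 0
  show ?case by (intro exI[of _ "{}"]) (simp add: card_mono case_prod_unfold)
next
  case (Suc t)
  then obtain E where E: "\<forall>e\<in>E. e \<subseteq> V \<and> card e = 2" "finite E" "card E \<le> t"
    "real (card {(A, B) \<in> P. \<forall>x\<in>A. \<forall>y\<in>B. {x, y} \<notin> E}) \<le> (63 / 64) ^ t * card P"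
    by blast
  define Q where "Q = {(A, B) \<in> P. \<forall>x\<in>A. \<forall>y\<in>B. {x, y} \<notin> E}"
  have "finite Q" unfolding Q_def using assms(3) by (rule rev_finite_subset) auto
  show ?case
  proof (cases "Q = {}")
    case True
    moreover have "0 \<le> (63 / 64) ^ Suc t * real (card P)" by simp
    ultimately show ?thesis
      using E(1-3) unfolding Q_def by (intro exI[of _ E]) (simp only: card.empty of_nat_0 le_SucI simp_thms)
  next
    case False
    define hit where "hit z = {(A, B) \<in> Q. fst z \<in> A \<and> snd z \<in> B}" for z
    have fin: "finite (hit z)" for z
      unfolding hit_def using \<open>finite Q\<close> by (rule rev_finite_subset) auto
    let ?m = "real (card V)"
    have m: "?m > 0" using assms by (simp add: card_gt_0_iff)
    have "card Q * (?m\<^sup>2 / 64) \<le> (\<Sum>(A, B)\<in>Q. real (card (A \<times> B)))"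
    proof -
      have "?m\<^sup>2 / 64 \<le> real (card (A \<times> B))" if "(A, B) \<in> Q" for A B
      proof -
        have "?m / 8 \<le> card A" "?m / 8 \<le> card B" using P[of A B] that by (auto simp: Q_def)
        then have "(?m / 8) * (?m / 8) \<le> real (card A) * real (card B)" by (intro mult_mono) auto
        then show ?thesis by (simp add: card_cartesian_product power2_eq_square)
      qed
      then show ?thesis
        using sum_mono[of Q "\<lambda>_. ?m\<^sup>2 / 64" "\<lambda>(A, B). real (card (A \<times> B))"] by auto
    qed
    also have "\<dots> = (\<Sum>(A, B)\<in>Q. \<Sum>z\<in>V \<times> V. of_bool (z \<in> A \<times> B))"
    proof (intro sum.cong refl, clarify)
      fix A B assume "(A, B) \<in> Q"
      then have "A \<subseteq> V" "B \<subseteq> V" using P[of A B] by (auto simp: Q_def)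
      then have "A \<times> B \<subseteq> V \<times> V" by auto
      then have "A \<times> B = {z \<in> V \<times> V. z \<in> A \<times> B}" by auto
      then have "real (card (A \<times> B)) = real (card {z \<in> V \<times> V. z \<in> A \<times> B})" by simp
      also have "\<dots> = (\<Sum>z\<in>V \<times> V. of_bool (z \<in> A \<times> B))"
        using assms(1) by (simp add: of_bool_def sum.If_cases Int_def)
      finally show "real (card (A \<times> B)) = (\<Sum>z\<in>V \<times> V. of_bool (z \<in> A \<times> B))" .
    qed
    also have "\<dots> = (\<Sum>z\<in>V \<times> V. \<Sum>(A, B)\<in>Q. of_bool (z \<in> A \<times> B))"
      unfolding case_prod_unfold by (rule sum.swap)
    also have "\<dots> = (\<Sum>z\<in>V \<times> V. real (card (hit z)))"
    proof (intro sum.cong refl)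
      fix z
      have "hit z = {p \<in> Q. z \<in> fst p \<times> snd p}" by (auto simp: hit_def mem_Times_iff)
      then show "(\<Sum>(A, B)\<in>Q. of_bool (z \<in> A \<times> B)) = real (card (hit z))"
        using \<open>finite Q\<close> by (simp add: of_bool_def sum.If_cases Int_def case_prod_unfold)
    qed
    finally have avg: "card Q * (?m\<^sup>2 / 64) \<le> (\<Sum>z\<in>V \<times> V. real (card (hit z)))" .
    have "\<exists>z\<in>V \<times> V. card Q / 64 \<le> card (hit z)"
    proof (rule ccontr)
      assume "\<not> ?thesis"
      then have "(\<Sum>z\<in>V \<times> V. real (card (hit z))) < (\<Sum>z\<in>V \<times> V. card Q / 64)"
        using assms by (intro sum_strict_mono) (auto simp: not_le)
      then show False using avg by (simp add: card_cartesian_product power2_eq_square mult.commute)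
    qed
    then obtain x y where xy: "x \<in> V" "y \<in> V" "card Q / 64 \<le> card (hit (x, y))" by auto
    have "card Q > 0" using False \<open>finite Q\<close> by (simp add: card_gt_0_iff)
    then have "hit (x, y) \<noteq> {}" using xy(3) by auto
    then obtain A B where "(A, B) \<in> P" "x \<in> A" "y \<in> B" by (auto simp: hit_def Q_def)
    \<comment> \<open>Disjointness of \<open>A\<close> and \<open>B\<close> makes the new edge a
      genuine one.\<close>
    then have "x \<noteq> y" using P by blast
    let ?E = "insert {x, y} E"
    have "{(A, B) \<in> P. \<forall>x\<in>A. \<forall>y\<in>B. {x, y} \<notin> ?E} \<subseteq> Q - hit (x, y)"
      by (auto simp: Q_def hit_def)
    then have "card {(A, B) \<in> P. \<forall>x\<in>A. \<forall>y\<in>B. {x, y} \<notin> ?E} \<le> card (Q - hit (x, y))"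
      using \<open>finite Q\<close> by (intro card_mono) auto
    also have "\<dots> = card Q - card (hit (x, y))"
      using fin by (intro card_Diff_subset) (auto simp: hit_def)
    finally have "real (card {(A, B) \<in> P. \<forall>x\<in>A. \<forall>y\<in>B. {x, y} \<notin> ?E}) \<le> 63 / 64 * card Q"
      using xy(3) by linarith
    also have "\<dots> \<le> (63 / 64) ^ Suc t * card P"
      using E(4) by (simp add: Q_def)
    finally show ?thesis
      using E xy \<open>x \<noteq> y\<close> by (intro exI[of _ ?E]) (auto simp: card_insert_if)
  qed
qed

text \<open>The handshake lemma. It bounds the number of vertices of high degree in the base graph,
  and its parity rules out an isomorphism of the gadget graphs.\<close>

lemma sum_degrees:
  assumes "finite V" "finite E" "\<And>e. e \<in> E \<Longrightarrow> e \<subseteq> V \<and> card e = 2"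
  shows "(\<Sum>v\<in>V. card {e\<in>E. v \<in> e}) = 2 * card E"
proof -
  have "(\<Sum>v\<in>V. card {e\<in>E. v \<in> e}) = (\<Sum>v\<in>V. \<Sum>e\<in>E. of_bool (v \<in> e))"
    using assms by (simp add: of_bool_def sum.If_cases Int_def)
  also have "\<dots> = (\<Sum>e\<in>E. \<Sum>v\<in>V. of_bool (v \<in> e))" by (rule sum.swap)
  also have "\<dots> = (\<Sum>e\<in>E. 2)"
  proof (intro sum.cong refl)
    fix e assume "e \<in> E"
    then have "V \<inter> {v. v \<in> e} = e" "card e = 2" using assms(3) by auto
    then show "(\<Sum>v\<in>V. of_bool (v \<in> e)) = (2::nat)"
      using assms(1) by (simp add: of_bool_def sum.If_cases)
  qed
  finally show ?thesis by simp
qed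

definition mixing :: "'a set \<Rightarrow> 'a set set \<Rightarrow> bool" where
  "mixing V E \<longleftrightarrow> (\<forall>A\<subseteq>V. \<forall>B\<subseteq>V. A \<inter> B = {} \<longrightarrow> card V \<le> 4 * card A \<longrightarrow> card V \<le> 4 * card B \<longrightarrow>
     (\<exists>x\<in>A. \<exists>y\<in>B. {x, y} \<in> E))"

text \<open>For \<open>m\<close> vertices, \<open>128 * m\<close> greedy edges join all disjoint
  pairs of sets of at least \<open>m / 8\<close> vertices. The degree sum is at most
  \<open>256 * m\<close>, so at most \<open>m / 8\<close> vertices exceed degree 2048. After their
  edges are deleted, sets of at least \<open>m / 4\<close> vertices are still joined.\<close>

lemma bounded_degree_mixing_graph:
  "\<exists>D::nat. \<forall>V :: 'a set. finite V \<and> V \<noteq> {} \<longrightarrow>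
     (\<exists>E. (\<forall>e\<in>E. e \<subseteq> V \<and> card e = 2) \<and> (\<forall>v\<in>V. card {e\<in>E. v \<in> e} \<le> D) \<and> mixing V E)"
proof (rule exI[of _ 2048], intro allI impI)
  fix V :: "'a set" assume "finite V \<and> V \<noteq> {}"
  then have V: "finite V" "V \<noteq> {}" by auto
  let ?m = "card V"
  have m: "?m > 0" using V by (simp add: card_gt_0_iff)
  define P where "P = {(A, B). A \<subseteq> V \<and> B \<subseteq> V \<and> A \<inter> B = {} \<and> ?m \<le> 8 * card A \<and> ?m \<le> 8 * card B}"
  have sub: "P \<subseteq> Pow V \<times> Pow V" by (auto simp: P_def)
  then have finP: "finite P" using V finite_subset by blast
  have "card P \<le> card (Pow V \<times> Pow V)" using sub V by (intro card_mono) auto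
  also have "\<dots> = 4 ^ ?m"
    using V by (simp add: card_cartesian_product card_Pow flip: power_mult_distrib)
  finally have cardP: "real (card P) \<le> 4 ^ ?m" by (metis of_nat_le_iff of_nat_power of_nat_numeral)
  obtain E where E: "\<forall>e\<in>E. e \<subseteq> V \<and> card e = 2" "finite E" "card E \<le> 128 * ?m"
    "real (card {(A, B) \<in> P. \<forall>x\<in>A. \<forall>y\<in>B. {x, y} \<notin> E}) \<le> (63 / 64) ^ (128 * ?m) * card P"
    using greedy_edges[OF V finP, of "128 * ?m"] unfolding P_def by blast
  have "(63 / 64) ^ (128 * ?m) * real (card P) \<le> (63 / 64) ^ (128 * ?m) * 4 ^ ?m"
    using cardP by (intro mult_left_mono) auto
  also have "\<dots> = ((63 / 64) ^ 128 * 4) ^ ?m" by (simp only: power_mult power_mult_distrib)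
  \<comment> \<open>The power \<open>(63 / 64) ^ 128\<close> lies below 1/4, so 128 edges per vertex
    outweigh the up to \<open>4 ^ ?m\<close> pairs.\<close>
  also have "\<dots> < 1"
    using m by (intro power_less_one_iff[THEN iffD2]) (auto simp: power_divide)
  finally have "card {(A, B) \<in> P. \<forall>x\<in>A. \<forall>y\<in>B. {x, y} \<notin> E} = 0" using E(4) by linarith
  moreover have "finite {(A, B) \<in> P. \<forall>x\<in>A. \<forall>y\<in>B. {x, y} \<notin> E}"
    using finP by (rule rev_finite_subset) auto
  ultimately have hit: "\<exists>x\<in>A. \<exists>y\<in>B. {x, y} \<in> E" if "(A, B) \<in> P" for A B
    using that by auto
  define Z where "Z = {v\<in>V. 2048 < card {e\<in>E. v \<in> e}}"
  have "finite Z" "Z \<subseteq> V" using V by (auto simp: Z_def)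
  have "2048 * card Z = (\<Sum>v\<in>Z. 2048)" by simp
  also have "\<dots> \<le> (\<Sum>v\<in>Z. card {e\<in>E. v \<in> e})" by (intro sum_mono) (auto simp: Z_def)
  also have "\<dots> \<le> (\<Sum>v\<in>V. card {e\<in>E. v \<in> e})" using V \<open>Z \<subseteq> V\<close> by (intro sum_mono2) auto
  also have "\<dots> = 2 * card E" using V E by (intro sum_degrees) auto
  finally have Z: "8 * card Z \<le> ?m" using E(3) by linarith
  \<comment> \<open>Vertices of high degree stay in the graph but become isolated.\<close>
  define E' where "E' = {e\<in>E. e \<inter> Z = {}}"
  have deg: "card {e\<in>E'. v \<in> e} \<le> 2048" if "v \<in> V" for v
  proof (cases "v \<in> Z")
    case True
    then have "{e\<in>E'. v \<in> e} = {}" by (auto simp: E'_def)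
    then show ?thesis by (metis card.empty le0)
  next
    case False
    have "card {e\<in>E'. v \<in> e} \<le> card {e\<in>E. v \<in> e}" using E(2) by (intro card_mono) (auto simp: E'_def)
    then show ?thesis using False that by (auto simp: Z_def)
  qed
  have "\<exists>x\<in>A. \<exists>y\<in>B. {x, y} \<in> E'"
    if AB: "A \<subseteq> V" "B \<subseteq> V" "A \<inter> B = {}" "?m \<le> 4 * card A" "?m \<le> 4 * card B" for A B
  proof -
    have "card A - card Z \<le> card (A - Z)" "card B - card Z \<le> card (B - Z)"
      using \<open>finite Z\<close> by (intro diff_card_le_card_Diff; simp)+
    then have "(A - Z, B - Z) \<in> P" using AB Z by (auto simp: P_def)
    from hit[OF this] show ?thesis by (auto simp: E'_def)
  qed
  then have "mixing V E'" by (simp add: mixing_def)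
  moreover have "\<forall>e\<in>E'. e \<subseteq> V \<and> card e = 2" using E(1) by (auto simp: E'_def)
  ultimately show "\<exists>E. (\<forall>e\<in>E. e \<subseteq> V \<and> card e = 2) \<and> (\<forall>v\<in>V. card {e\<in>E. v \<in> e} \<le> 2048) \<and> mixing V E"
    using deg by blast
qed

section \<open>Edge sets with prescribed vertices of odd degree\<close>

definition odd_degree :: "'a set set \<Rightarrow> 'a \<Rightarrow> bool" where
  "odd_degree F v \<longleftrightarrow> odd (card {e\<in>F. v \<in> e})"

text \<open>A path from \<open>r\<close> to \<open>s\<close> off \<open>W\<close>, kept only modulo
  2: a T-join for the two endpoints. Such edge sets can be added by symmetric difference, and only
  their parities matter to the gadgets.\<close>

definition joined_outside :: "'a set set \<Rightarrow> 'a set \<Rightarrow> 'a \<Rightarrow> 'a \<Rightarrow> bool" where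
  "joined_outside E W r s \<longleftrightarrow>
     (\<exists>F\<subseteq>E. (\<forall>e\<in>F. e \<inter> W = {}) \<and> (\<forall>v. odd_degree F v \<longleftrightarrow> (v = r) \<noteq> (v = s)))"

lemma odd_card_sym_diff:
  assumes "finite A" "finite B"
  shows "odd (card (sym_diff A B)) \<longleftrightarrow> odd (card A) \<noteq> odd (card B)"
proof -
  have "card (sym_diff A B) = card (A - B) + card (B - A)"
    using assms by (intro card_Un_disjoint) auto
  moreover have "card A = card (A - B) + card (A \<inter> B)" "card B = card (B - A) + card (A \<inter> B)"
    using assms by (metis add.commute card_Int_Diff, metis add.commute Int_commute card_Int_Diff)
  ultimately show ?thesis by auto
qed

lemma odd_degree_sym_diff:
  assumes "finite F" "finite F'"
  shows "odd_degree (sym_diff F F') v \<longleftrightarrow> odd_degree F v \<noteq> odd_degree F' v"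
proof -
  have "{e \<in> sym_diff F F'. v \<in> e} = sym_diff {e\<in>F. v \<in> e} {e\<in>F'. v \<in> e}" by auto
  then show ?thesis using assms by (simp add: odd_degree_def odd_card_sym_diff)
qed

lemma joined_outside_refl: "joined_outside E W r r"
  unfolding joined_outside_def by (intro exI[of _ "{}"]) (simp add: odd_degree_def)

text \<open>Symmetric difference replaces concatenation; the two odd degrees at \<open>s\<close>
  cancel, and no path has to be extracted.\<close>

lemma joined_outside_trans:
  assumes "finite E" "joined_outside E W r s" "joined_outside E W s t"
  shows "joined_outside E W r t"
proof -
  obtain F where F: "F \<subseteq> E" "\<forall>e\<in>F. e \<inter> W = {}" "\<forall>v. odd_degree F v \<longleftrightarrow> (v = r) \<noteq> (v = s)"
    using assms(2) unfolding joined_outside_def by blast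
  obtain F' where F': "F' \<subseteq> E" "\<forall>e\<in>F'. e \<inter> W = {}" "\<forall>v. odd_degree F' v \<longleftrightarrow> (v = s) \<noteq> (v = t)"
    using assms(3) unfolding joined_outside_def by blast
  have fin: "finite F" "finite F'" using F(1) F'(1) assms(1) finite_subset by blast+
  have "odd_degree (sym_diff F F') v \<longleftrightarrow> (v = r) \<noteq> (v = t)" for v
    unfolding odd_degree_sym_diff[OF fin] F(3)[rule_format] F'(3)[rule_format] by argo
  moreover have "sym_diff F F' \<subseteq> E" "\<forall>e\<in>sym_diff F F'. e \<inter> W = {}"
    using F(1,2) F'(1,2) by blast+
  ultimately show ?thesis
    unfolding joined_outside_def by (intro exI[of _ "sym_diff F F'"] conjI allI)
qed

lemma joined_outside_edge:
  assumes "{r, s} \<in> E" "r \<noteq> s" "r \<notin> W" "s \<notin> W"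
  shows "joined_outside E W r s"
proof -
  have "{e \<in> {{r, s}}. v \<in> e} = (if v = r \<or> v = s then {{r, s}} else {})" for v by auto
  then show ?thesis
    unfolding joined_outside_def odd_degree_def using assms by (intro exI[of _ "{{r, s}}"]) auto
qed

text \<open>Take a smallest union \<open>S\<close> of components with more than half of the
  vertices. A proper subunion with a quarter of the vertices would, by minimality and the bound on
  \<open>W\<close>, leave a quarter outside, and mixing would join the two. So proper subunions are
  smaller than a quarter, and two of them cannot make up \<open>S\<close>.\<close>

lemma giant_component:
  assumes V: "finite V" "V \<noteq> {}"
    and E: "finite E" "\<And>e. e \<in> E \<Longrightarrow> e \<subseteq> V \<and> card e = 2"
    and mixing: "mixing V E"
    and W: "finite W" "4 * card W \<le> card V"
  shows "\<exists>S\<subseteq>V - W. card V < 2 * card S \<and> (\<forall>r\<in>S. \<forall>s\<in>S. joined_outside E W r s)"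
proof -
  have m: "card V > 0" using V by (simp add: card_gt_0_iff)
  \<comment> \<open>These are the unions of components of the graph induced on
    \<open>V - W\<close>.\<close>
  define closed where "closed S \<longleftrightarrow> S \<subseteq> V - W \<and> (\<forall>x\<in>S. \<forall>y\<in>V - W. {x, y} \<in> E \<longrightarrow> y \<in> S)" for S
  have "card V - card W \<le> card (V - W)" by (rule diff_card_le_card_Diff) (rule W)
  then have "closed (V - W) \<and> card V < 2 * card (V - W)" using W m by (auto simp: closed_def)
  from ex_has_least_nat[of "\<lambda>S. closed S \<and> card V < 2 * card S", OF this, of card]
  obtain S where S: "closed S" "card V < 2 * card S"
    and least: "\<And>T. closed T \<Longrightarrow> card V < 2 * card T \<Longrightarrow> card S \<le> card T" by blast
  have SV: "S \<subseteq> V - W" using S by (simp add: closed_def)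
  then have finS: "finite S" using V finite_subset by blast
  have small: "4 * card U < card V" if U: "closed U" "U \<subset> S" for U
  proof (rule ccontr)
    assume ge: "\<not> 4 * card U < card V"
    have "card U < card S" using U finS by (simp add: psubset_card_mono)
    then have "2 * card U \<le> card V" using least[OF U(1)] by force
    moreover have "card V - card W - card U \<le> card (V - W - U)"
    proof -
      have "finite U" using U(2) finS finite_subset by blast
      then have "card (V - W) - card U \<le> card (V - W - U)" by (rule diff_card_le_card_Diff)
      moreover have "card V - card W \<le> card (V - W)" using W(1) by (rule diff_card_le_card_Diff)
      ultimately show ?thesis by linarith
    qed
    ultimately have "card V \<le> 4 * card (V - W - U)" using W by linarith
    moreover have "U \<subseteq> V" "V - W - U \<subseteq> V" "U \<inter> (V - W - U) = {}" "card V \<le> 4 * card U"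
      using ge U by (auto simp: closed_def)
    ultimately obtain x y where "x \<in> U" "y \<in> V - W - U" "{x, y} \<in> E"
      using mixing unfolding mixing_def by meson
    then show False using U by (auto simp: closed_def)
  qed
  have connected: "T = S" if T: "closed T" "T \<subseteq> S" "T \<noteq> {}" for T
  proof (rule ccontr)
    assume "T \<noteq> S"
    have "closed (S - T)"
      using S(1) T unfolding closed_def by (metis Diff_iff insert_commute subset_iff)
    then have "4 * card T < card V" "4 * card (S - T) < card V"
      using small T \<open>T \<noteq> S\<close> by auto
    moreover have "card S = card T + card (S - T)"
      using T finS by (simp add: card_Diff_subset card_mono finite_subset)
    ultimately show False using S(2) by linarith
  qed
  have "joined_outside E W r s" if "r \<in> S" "s \<in> S" for r s
  proof -
    \<comment> \<open>The part of \<open>S\<close> reachable from \<open>r\<close> is closed and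
      contains \<open>r\<close>, hence is all of \<open>S\<close>.\<close>
    have "closed {t\<in>S. joined_outside E W r t}"
      unfolding closed_def
    proof safe
      fix x y assume x: "x \<in> S" "joined_outside E W r x" and y: "y \<in> V" "y \<notin> W" "{x, y} \<in> E"
      then have "x \<noteq> y" using E(2)[OF y(3)] by auto
      then show "joined_outside E W r y"
        using joined_outside_trans[OF E(1) x(2) joined_outside_edge[OF y(3)]] x(1) y SV by auto
      show "y \<in> S" using S x y by (auto simp: closed_def)
    qed (use SV in auto)
    from connected[OF this] show ?thesis using that joined_outside_refl[of E W r] by blast
  qed
  then show ?thesis using S SV by blast
qed

section \<open>The gadget graphs\<close>

abbreviation incident :: "'a set set \<Rightarrow> 'a \<Rightarrow> 'a set set" where
  "incident E v \<equiv> {e\<in>E. v \<in> e}"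

text \<open>A Cai-Fuerer-Immerman gadget at each base vertex v carries all subsets of the edges at v;
  those of the parity prescribed by the charge c take part in edges and the others stay isolated.
  A clique of markers, of which the first v + 1 are joined to the gadget at v, takes the role of
  vertex colours.\<close>

type_synonym gadget_vertex = "(nat \<times> nat set set) + nat"

definition gadget_vertices :: "nat \<Rightarrow> nat set set \<Rightarrow> nat \<Rightarrow> gadget_vertex set" where
  "gadget_vertices n E M = Inl ` (SIGMA v:{..<n}. Pow (incident E v)) \<union> Inr ` {..<M}"

definition charged :: "(nat \<Rightarrow> bool) \<Rightarrow> nat \<Rightarrow> nat set set \<Rightarrow> bool" where
  "charged c v \<alpha> \<longleftrightarrow> (odd (card \<alpha>) \<longleftrightarrow> c v)"

fun gadget_adj :: "nat set set \<Rightarrow> (nat \<Rightarrow> bool) \<Rightarrow> gadget_vertex \<Rightarrow> gadget_vertex \<Rightarrow> bool" where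
  "gadget_adj E c (Inl (v, \<alpha>)) (Inl (w, \<beta>)) \<longleftrightarrow>
     {v, w} \<in> E \<and> charged c v \<alpha> \<and> charged c w \<beta> \<and> ({v, w} \<in> \<alpha> \<longleftrightarrow> {v, w} \<in> \<beta>)"
| "gadget_adj E c (Inl (v, \<alpha>)) (Inr j) \<longleftrightarrow> charged c v \<alpha> \<and> j \<le> v"
| "gadget_adj E c (Inr j) (Inl (v, \<alpha>)) \<longleftrightarrow> charged c v \<alpha> \<and> j \<le> v"
| "gadget_adj E c (Inr i) (Inr j) \<longleftrightarrow> i \<noteq> j"

lemma gadget_adj_sym: "gadget_adj E c x y \<longleftrightarrow> gadget_adj E c y x"
  by (induction E c x y rule: gadget_adj.induct) (auto simp: insert_commute)

section \<open>Shifts of the gadgets\<close>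

fun base :: "gadget_vertex \<Rightarrow> nat set" where
  "base (Inl (v, \<alpha>)) = {v}"
| "base (Inr j) = {}"

fun shift :: "nat set set \<Rightarrow> gadget_vertex \<Rightarrow> gadget_vertex" where
  "shift F (Inl (v, \<alpha>)) = Inl (v, sym_diff \<alpha> (incident F v))"
| "shift F (Inr j) = Inr j"

lemma base_shift [simp]: "base (shift F x) = base x"
  by (cases "(F, x)" rule: shift.cases) auto

text \<open>Each assignment forbids the defect at one base vertex at most; markers forbid none, as
  every shift fixes them.\<close>

lemma card_base: "card (base x) \<le> 1"
  by (cases x rule: base.cases) auto

lemma finite_base [simp]: "finite (base x)"
  by (cases x rule: base.cases) auto

lemma bij_shift:
  assumes "F \<subseteq> E"
  shows "bij_betw (shift F) (gadget_vertices n E M) (gadget_vertices n E M)"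
proof -
  have "shift F (shift F x) = x" for x
    by (cases "(F, x)" rule: shift.cases) auto
  moreover have "shift F x \<in> gadget_vertices n E M" if "x \<in> gadget_vertices n E M" for x
    using that assms by (auto simp: gadget_vertices_def image_iff)
  ultimately show ?thesis by (intro bij_betw_byWitness[of _ "shift F"]) auto
qed

text \<open>The parity of \<open>\<alpha>\<close> changes by the degree of \<open>v\<close> in
  \<open>F\<close>, so it changes exactly where the two charges differ.\<close>

lemma charged_shift:
  assumes "finite E" "F \<subseteq> E" "\<alpha> \<subseteq> incident E v" "odd_degree F v \<longleftrightarrow> v = z"
  shows "charged (\<lambda>v. v = z) v (sym_diff \<alpha> (incident F v)) \<longleftrightarrow> charged (\<lambda>_. False) v \<alpha>"
proof -
  have "finite \<alpha>" using assms(1,3) by (auto intro: finite_subset[of \<alpha> E])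
  moreover have "finite (incident F v)" using assms(1,2) by (auto intro: finite_subset[of _ E])
  ultimately show ?thesis
    using assms(4) by (auto simp: charged_def odd_card_sym_diff odd_degree_def)
qed

text \<open>An edge of \<open>F\<close> is toggled at both of its ends, so agreement of two subsets
  on it persists. Charges are corrected at every base vertex other than \<open>r\<close>.\<close>

lemma gadget_adj_shift:
  assumes "finite E" "F \<subseteq> E" "\<And>v. odd_degree F v \<longleftrightarrow> (v = z) \<noteq> (v = r)"
    and "x \<in> gadget_vertices n E M" "y \<in> gadget_vertices n E M" "r \<notin> base x" "r \<notin> base y"
  shows "gadget_adj E (\<lambda>v. v = z) (shift F x) (shift F y) \<longleftrightarrow> gadget_adj E (\<lambda>_. False) x y"
proof -
  have "charged (\<lambda>v. v = z) v (sym_diff \<alpha> (incident F v)) \<longleftrightarrow> charged (\<lambda>_. False) v \<alpha>"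
    if "\<alpha> \<subseteq> incident E v" "v \<noteq> r" for v \<alpha>
    using that assms by (intro charged_shift[of E]) auto
  then show ?thesis
    using assms(4-7) by (auto simp: gadget_vertices_def)
qed

text \<open>Degrees identify the markers, and the number of neighbouring markers identifies the
  gadget. Hence the images of the empty subsets stay in their gadgets and, by adjacency, agree on
  shared edges. They glue to an edge set whose only vertex of odd degree is
  \<open>z\<close>.\<close>

lemma no_gadget_isomorphism:
  assumes E: "finite E" "\<And>e. e \<in> E \<Longrightarrow> e \<subseteq> {..<n} \<and> card e = 2"
    and M: "card (SIGMA v:{..<n}. Pow (incident E v)) + n + 2 \<le> M" and z: "z < n"
    and f: "bij_betw f (gadget_vertices n E M) (gadget_vertices n E M)"
    and adj: "\<And>x y. x \<in> gadget_vertices n E M \<Longrightarrow> y \<in> gadget_vertices n E M \<Longrightarrow>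
      gadget_adj E (\<lambda>_. False) x y \<longleftrightarrow> gadget_adj E (\<lambda>v. v = z) (f x) (f y)"
  shows False
proof -
  let ?V = "gadget_vertices n E M" and ?R = "SIGMA v:{..<n}. Pow (incident E v)"
  have finR: "finite ?R" using E(1) by auto
  then have finV: "finite ?V" by (simp add: gadget_vertices_def)
  define nb where "nb c x = {y\<in>?V. gadget_adj E c x y}" for c x
  have fin_nb: "finite (nb c x)" for c x using finV by (simp add: nb_def)
  have f_nb: "bij_betw f (nb (\<lambda>_. False) x) (nb (\<lambda>v. v = z) (f x))" if "x \<in> ?V" for x
    unfolding nb_def by (rule bij_betw_Collect[OF f]) (use adj that in auto)
  \<comment> \<open>The clique gives a marker at least \<open>M - 1\<close> neighbours. The summand
    2 in the bound on \<open>M\<close> pushes this above \<open>card ?R + n\<close>, the maximum for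
    gadget vertices.\<close>
  have large: "M \<le> card (nb c (Inr j)) + 1" if "j < M" for c j
  proof -
    have "Inr ` ({..<M} - {j}) \<subseteq> nb c (Inr j)" by (auto simp: nb_def gadget_vertices_def)
    then have "card (Inr ` ({..<M} - {j}) :: gadget_vertex set) \<le> card (nb c (Inr j))"
      by (rule card_mono[OF fin_nb])
    then show ?thesis using that by (simp add: card_image)
  qed
  have less: "card (nb c (Inl p)) \<le> card ?R + n" if "Inl p \<in> ?V" for c p
  proof -
    have "nb c (Inl p) \<subseteq> Inl ` ?R \<union> Inr ` {..<n}"
      using that by (cases p) (auto simp: nb_def gadget_vertices_def)
    then have "card (nb c (Inl p)) \<le> card (Inl ` ?R \<union> Inr ` {..<n} :: gadget_vertex set)"
      using finR by (intro card_mono) auto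
    also have "\<dots> \<le> card (Inl ` ?R :: gadget_vertex set) + card (Inr ` {..<n} :: gadget_vertex set)"
      by (rule card_Un_le)
    also have "\<dots> = card ?R + n" by (simp add: card_image)
    finally show ?thesis .
  qed
  have fV: "f x \<in> ?V" if "x \<in> ?V" for x using f that by (auto simp: bij_betw_def)
  have isl_f: "isl (f x) \<longleftrightarrow> isl x" if "x \<in> ?V" for x
  proof -
    have *: "isl y \<longleftrightarrow> card (nb c y) \<le> card ?R + n" if "y \<in> ?V" for c y
    proof (cases y)
      case (Inl p)
      then show ?thesis using less[of p c] that by simp
    next
      case (Inr j)
      then show ?thesis using large[of j c] that M by (auto simp: gadget_vertices_def)
    qed
    show ?thesis
      using *[OF that, of "\<lambda>_. False"] *[OF fV[OF that], of "\<lambda>v. v = z"]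
        bij_betw_same_card[OF f_nb[OF that]] by simp
  qed
  \<comment> \<open>The number of neighbouring markers acts as a colour: \<open>Suc v\<close> for
    charged vertices over \<open>v\<close>, and 0 for the isolated ones.\<close>
  define mk where "mk c x = {y \<in> nb c x. \<not> isl y}" for c x
  have card_mk: "card (mk c (Inl (v, \<alpha>))) = (if charged c v \<alpha> then Suc v else 0)"
    if "Inl (v, \<alpha>) \<in> ?V" for c v \<alpha>
  proof -
    have "v < M" using that M by (auto simp: gadget_vertices_def)
    then have "mk c (Inl (v, \<alpha>)) = (if charged c v \<alpha> then Inr ` {..v} else {})"
      by (auto simp: mk_def nb_def gadget_vertices_def)
    then show ?thesis by (simp add: card_image)
  qed
  have card_mk_f: "card (mk (\<lambda>v. v = z) (f x)) = card (mk (\<lambda>_. False) x)" if "x \<in> ?V" for x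
  proof -
    have "bij_betw f (mk (\<lambda>_. False) x) (mk (\<lambda>v. v = z) (f x))"
      unfolding mk_def
    proof (rule bij_betw_Collect[OF f_nb[OF that]])
      show "\<And>y. y \<in> nb (\<lambda>_. False) x \<Longrightarrow> (\<not> isl (f y)) \<longleftrightarrow> (\<not> isl y)"
        using isl_f by (auto simp: nb_def)
    qed
    then show ?thesis by (simp add: bij_betw_same_card)
  qed
  \<comment> \<open>The empty subset is charged at every \<open>v\<close> in the first graph, so its
    image must be a charged vertex over the same \<open>v\<close>.\<close>
  define \<tau> where "\<tau> v = snd (projl (f (Inl (v, {}))))" for v
  have \<tau>: "f (Inl (v, {})) = Inl (v, \<tau> v)" "charged (\<lambda>v. v = z) v (\<tau> v)" "\<tau> v \<subseteq> incident E v"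
    if "v < n" for v
  proof -
    have x: "Inl (v, {}) \<in> ?V" using that by (auto simp: gadget_vertices_def)
    obtain w \<beta> where w: "f (Inl (v, {})) = Inl (w, \<beta>)"
      using isl_f[OF x] by (metis isl_def prod.exhaust sum.disc(1))
    have wV: "Inl (w, \<beta>) \<in> ?V" using fV[OF x] w by simp
    have "card (mk (\<lambda>v. v = z) (Inl (w, \<beta>))) = Suc v"
      using card_mk_f[OF x] card_mk[OF x] by (simp add: w charged_def)
    then have "w = v" "charged (\<lambda>v. v = z) w \<beta>"
      using card_mk[OF wV] by (auto split: if_splits)
    then show "f (Inl (v, {})) = Inl (v, \<tau> v)" "charged (\<lambda>v. v = z) v (\<tau> v)" "\<tau> v \<subseteq> incident E v"
      using w wV by (auto simp: \<tau>_def gadget_vertices_def)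
  qed
  have agree: "{v, w} \<in> \<tau> v \<longleftrightarrow> {v, w} \<in> \<tau> w" if "{v, w} \<in> E" for v w
  proof -
    have vw: "v < n" "w < n" using E(2)[OF that] by auto
    then have "gadget_adj E (\<lambda>v. v = z) (f (Inl (v, {}))) (f (Inl (w, {})))"
      using adj[of "Inl (v, {})" "Inl (w, {})"] that by (auto simp: gadget_vertices_def charged_def)
    then show ?thesis using vw by (simp add: \<tau>(1))
  qed
  \<comment> \<open>By \<open>agree\<close>, the local subsets are the stars of one global edge
    set.\<close>
  define F where "F = (\<Union>v<n. \<tau> v)"
  have FE: "F \<subseteq> E" using \<tau>(3) by (auto simp: F_def)
  have F: "incident F v = \<tau> v" if "v < n" for v
  proof (intro subset_antisym subsetI)
    fix e assume "e \<in> incident F v"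
    then obtain w where w: "w < n" "e \<in> \<tau> w" "v \<in> e" by (auto simp: F_def)
    then have e: "e \<in> E" "w \<in> e" using \<tau>(3) by auto
    then obtain a b where "e = {a, b}" using E(2) by (metis card_2_iff)
    then have "v = w \<or> e = {v, w}" using w e by auto
    then show "e \<in> \<tau> v" using agree[of v w] e w by auto
  qed (use \<tau>(3)[OF that] that in \<open>auto simp: F_def\<close>)
  have "(\<Sum>v<n. card (incident F v)) = 2 * card F"
    using FE E by (intro sum_degrees) (auto intro: finite_subset)
  moreover have "(\<Sum>v<n. card (incident F v)) = card (\<tau> z) + (\<Sum>v\<in>{..<n}-{z}. card (\<tau> v))"
    using z F by (simp add: sum.remove[of _ z])
  moreover have "even (\<Sum>v\<in>{..<n}-{z}. card (\<tau> v))"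
    using \<tau>(2) by (intro dvd_sum) (auto simp: charged_def)
  moreover have "odd (card (\<tau> z))" using \<tau>(2)[OF z] by (simp add: charged_def)
  ultimately show False by (metis dvd_triv_left even_add)
qed

section \<open>Transport to the vertex set \<open>{1..N}\<close>\<close>

definition pullback_edges :: "nat \<Rightarrow> (nat \<Rightarrow> 'a) \<Rightarrow> ('a \<Rightarrow> 'a \<Rightarrow> bool) \<Rightarrow> nat set set" where
  "pullback_edges N d R = {{a, b} | a b. a \<in> {1..N} \<and> b \<in> {1..N} \<and> R (d a) (d b)}"

lemma pullback_edges_iff:
  assumes "\<And>x y. R x y \<longleftrightarrow> R y x" "a \<in> {1..N}" "b \<in> {1..N}"
  shows "{a, b} \<in> pullback_edges N d R \<longleftrightarrow> R (d a) (d b)"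
  using assms unfolding pullback_edges_def by (auto simp: doubleton_eq_iff)

lemma simple_graph_pullback:
  assumes "\<And>a. a \<in> {1..N} \<Longrightarrow> \<not> R (d a) (d a)"
  shows "simple_graph N (pullback_edges N d R)"
  unfolding simple_graph_def pullback_edges_def
proof safe
  fix a b assume "a \<in> {1..N}" "b \<in> {1..N}" "R (d a) (d b)"
  moreover from this have "a \<noteq> b" using assms by auto
  ultimately show "card {a, b} = 2" by simp
qed

lemma isomorphic_pullbackD:
  assumes d: "bij_betw d {1..N} V" and sym: "\<And>x y. R x y \<longleftrightarrow> R y x" "\<And>x y. R' x y \<longleftrightarrow> R' y x"
    and iso: "isomorphic N (pullback_edges N d R) (pullback_edges N d R')"
  shows "\<exists>f. bij_betw f V V \<and> (\<forall>x\<in>V. \<forall>y\<in>V. R x y \<longleftrightarrow> R' (f x) (f y))"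
proof -
  obtain \<psi> where \<psi>: "bij_betw \<psi> {1..N} {1..N}" "\<And>a b. a \<in> {1..N} \<Longrightarrow> b \<in> {1..N} \<Longrightarrow>
      {a, b} \<in> pullback_edges N d R \<longleftrightarrow> {\<psi> a, \<psi> b} \<in> pullback_edges N d R'"
    using iso unfolding isomorphic_def graph_iso_def by blast
  define e where "e = the_inv_into {1..N} d"
  have e: "bij_betw e V {1..N}" unfolding e_def by (rule bij_betw_the_inv_into[OF d])
  have de: "d (e x) = x" if "x \<in> V" for x
    using that d unfolding e_def by (simp add: bij_betw_def f_the_inv_into_f)
  have mem: "e x \<in> {1..N}" "\<psi> (e x) \<in> {1..N}" if "x \<in> V" for x
    using that e \<psi>(1) by (meson bij_betwE)+
  have "bij_betw (d \<circ> \<psi> \<circ> e) V V"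
    using bij_betw_trans[OF e bij_betw_trans[OF \<psi>(1) d]] by (simp add: comp_assoc)
  moreover have "R x y \<longleftrightarrow> R' ((d \<circ> \<psi> \<circ> e) x) ((d \<circ> \<psi> \<circ> e) y)" if "x \<in> V" "y \<in> V" for x y
    using \<psi>(2)[OF mem(1)[OF that(1)] mem(1)[OF that(2)]] mem that
    by (simp add: pullback_edges_iff sym de del: atLeastAtMost_iff)
  ultimately show ?thesis by blast
qed

section \<open>Weights from random shifts\<close>

locale gadget_pair =
  fixes n :: nat and E :: "nat set set" and M z N :: nat and d :: "nat \<Rightarrow> gadget_vertex"
    and comp :: "nat set \<Rightarrow> nat set"
  assumes finite_E: "finite E"
    and d: "bij_betw d {1..N} (gadget_vertices n E M)"
    and comp: "\<And>W. finite W \<Longrightarrow> 4 * card W \<le> n \<Longrightarrow>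
      comp W \<subseteq> {..<n} - W \<and> n < 2 * card (comp W) \<and>
      (\<forall>r\<in>comp W. \<forall>s\<in>comp W. joined_outside E W r s)"
    and z: "z \<in> comp {}"
begin

text \<open>The shifts by these edge sets are isomorphisms except at the gadget of r.\<close>

definition flows :: "nat \<Rightarrow> nat set set set" where
  "flows r = {F. F \<subseteq> E \<and> (\<forall>v. odd_degree F v \<longleftrightarrow> (v = z) \<noteq> (v = r))}"

definition realized :: "nat set set \<Rightarrow> (nat \<times> nat) set \<Rightarrow> bool" where
  "realized F I \<longleftrightarrow> (\<forall>(a, b)\<in>I. shift F (d a) = d b)"

text \<open>A probability under the uniform distribution on \<open>flows r\<close>. If there are no
  flows, the quotient is 0; this matters only for normalization, settled in
  \<open>pseudo_empty\<close>.\<close>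

definition freq :: "nat \<Rightarrow> (nat \<times> nat) set \<Rightarrow> real" where
  "freq r I = card {F\<in>flows r. realized F I} / card (flows r)"

definition bases :: "(nat \<times> nat) set \<Rightarrow> nat set" where
  "bases I = (\<Union>(a, b)\<in>I. base (d a))"

text \<open>The defect is put anywhere in the large component that avoids the gadgets of
  \<open>I\<close>; \<open>pseudo_eq_freq\<close> removes the dependence on the choice. For large
  \<open>I\<close> the value is unspecified but still nonnegative.\<close>

definition pseudo :: "(nat \<times> nat) set \<Rightarrow> real" where
  "pseudo I = freq (SOME r. r \<in> comp (bases I)) I"

lemma finite_flows: "finite (flows r)"
  using finite_E by (intro finite_subset[of "flows r" "Pow E"]) (auto simp: flows_def)

lemma flows_sym_diff:
  assumes "F \<in> flows r" "F' \<subseteq> E" "\<forall>v. odd_degree F' v \<longleftrightarrow> (v = r) \<noteq> (v = s)"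
  shows "sym_diff F F' \<in> flows s"
proof -
  have F: "F \<subseteq> E" "\<forall>v. odd_degree F v \<longleftrightarrow> (v = z) \<noteq> (v = r)" using assms(1) by (auto simp: flows_def)
  have fin: "finite F" "finite F'" using F(1) assms(2) finite_E finite_subset by blast+
  have "odd_degree (sym_diff F F') v \<longleftrightarrow> (v = z) \<noteq> (v = s)" for v
    unfolding odd_degree_sym_diff[OF fin] F(2)[rule_format] assms(3)[rule_format] by argo
  then show ?thesis using F(1) assms(2) by (auto simp: flows_def)
qed

text \<open>No edge of \<open>F'\<close> touches a base vertex of \<open>I\<close>, so the gadgets
  there are shifted as before.\<close>

lemma realized_sym_diff:
  assumes "\<forall>e\<in>F'. e \<inter> bases I = {}"
  shows "realized (sym_diff F F') I \<longleftrightarrow> realized F I"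
proof -
  have "shift (sym_diff F F') (d a) = shift F (d a)" if "(a, b) \<in> I" for a b
  proof (cases "d a")
    case (Inl p)
    obtain v \<alpha> where p: "p = (v, \<alpha>)" by fastforce
    have "v \<in> bases I" using that by (auto simp: bases_def Inl p intro!: bexI[of _ "(a, b)"])
    then have "incident (sym_diff F F') v = incident F v" using assms by blast
    then show ?thesis by (simp only: Inl p shift.simps)
  qed simp
  then show ?thesis unfolding realized_def by auto
qed

text \<open>Symmetric difference with a fixed path off \<open>W\<close> moves the defect between
  \<open>r\<close> and \<open>s\<close> and is its own inverse.\<close>

lemma card_realized_joined:
  assumes "joined_outside E W r s" "bases I \<subseteq> W"
  shows "card {F\<in>flows r. realized F I} = card {F\<in>flows s. realized F I}"
proof -
  obtain F' where F': "F' \<subseteq> E" "\<forall>e\<in>F'. e \<inter> W = {}" "\<forall>v. odd_degree F' v \<longleftrightarrow> (v = r) \<noteq> (v = s)"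
    using assms(1) unfolding joined_outside_def by blast
  have "\<forall>e\<in>F'. e \<inter> bases I = {}" using F'(2) assms(2) by blast
  note realized = realized_sym_diff[OF this]
  have odd': "\<forall>v. odd_degree F' v \<longleftrightarrow> (v = s) \<noteq> (v = r)" using F'(3) by metis
  have inv: "sym_diff (sym_diff F F') F' = F" for F by auto
  have "bij_betw (\<lambda>F. sym_diff F F') {F\<in>flows r. realized F I} {F\<in>flows s. realized F I}"
  proof (rule bij_betw_byWitness[of _ "\<lambda>F. sym_diff F F'"])
    show "(\<lambda>F. sym_diff F F') ` {F\<in>flows r. realized F I} \<subseteq> {F\<in>flows s. realized F I}"
      using flows_sym_diff[OF _ F'(1,3)] realized by blast
    show "(\<lambda>F. sym_diff F F') ` {F\<in>flows s. realized F I} \<subseteq> {F\<in>flows r. realized F I}"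
      using flows_sym_diff[OF _ F'(1) odd'] realized by blast
  qed (simp_all only: inv simp_thms ball_simps)
  then show ?thesis by (rule bij_betw_same_card)
qed

text \<open>The case of the empty set of assignments equates the denominators, since every flow
  realizes it.\<close>

lemma freq_joined:
  assumes "joined_outside E W r s" "bases I \<subseteq> W"
  shows "freq r I = freq s I"
  using card_realized_joined[OF assms] card_realized_joined[OF assms(1), of "{}"]
  by (simp add: freq_def realized_def bases_def)

lemma card_bases: "finite I \<Longrightarrow> card (bases I) \<le> card I"
proof -
  assume "finite I"
  then have "card (bases I) \<le> (\<Sum>i\<in>I. card (base (d (fst i))))"
    unfolding bases_def case_prod_unfold by (rule card_UN_le)
  also have "\<dots> \<le> (\<Sum>i\<in>I. 1)" by (intro sum_mono card_base)
  finally show ?thesis by simp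
qed

lemma bases_insert: "bases (insert (a, b) I) = base (d a) \<union> bases I"
  by (simp add: bases_def)

text \<open>Both \<open>comp (bases I)\<close> and \<open>comp W\<close> contain more than half of
  the base vertices, so they share some \<open>t\<close>. The defect moves to \<open>t\<close>
  within the first component and on to \<open>r\<close> within the second.\<close>

lemma pseudo_eq_freq:
  assumes "bases I \<subseteq> W" "finite W" "4 * card W \<le> n" "r \<in> comp W"
  shows "pseudo I = freq r I"
proof -
  let ?B = "bases I"
  have "card ?B \<le> card W" using assms by (intro card_mono)
  then have B: "finite ?B" "4 * card ?B \<le> n" using assms finite_subset by auto
  note cB = comp[OF B] and cW = comp[OF assms(2,3)]
  have "comp ?B \<noteq> {}" using cB by auto
  then have s: "(SOME r. r \<in> comp ?B) \<in> comp ?B" by (simp add: some_in_eq)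
  have "comp ?B \<inter> comp W \<noteq> {}"
  proof
    assume "comp ?B \<inter> comp W = {}"
    moreover have "finite (comp ?B)" "finite (comp W)" using cB cW finite_subset by blast+
    ultimately have "card (comp ?B) + card (comp W) = card (comp ?B \<union> comp W)"
      by (simp add: card_Un_disjoint)
    also have "\<dots> \<le> card {..<n}" using cB cW by (intro card_mono) auto
    finally show False using cB cW by simp
  qed
  then obtain t where t: "t \<in> comp ?B" "t \<in> comp W" by blast
  have "pseudo I = freq t I"
    unfolding pseudo_def using cB s t by (intro freq_joined[of ?B]) auto
  also have "\<dots> = freq r I"
    using cW t assms by (intro freq_joined[of W]) auto
  finally show ?thesis .
qed

text \<open>Since \<open>z\<close> lies in \<open>comp {}\<close>, the defect may be put at
  \<open>z\<close>, where the empty edge set is a flow and the denominator is positive.\<close>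

lemma pseudo_empty: "pseudo {} = 1"
proof -
  have "joined_outside E {} z z" by (rule joined_outside_refl)
  then have "flows z \<noteq> {}" unfolding joined_outside_def flows_def by blast
  then have "freq z {} = 1" using finite_flows[of z] by (simp add: freq_def realized_def)
  then show ?thesis using pseudo_eq_freq[of "{}" "{}" z] z by (simp add: bases_def)
qed

lemma pseudo_nonneg: "pseudo I \<ge> 0"
  by (simp add: pseudo_def freq_def)

lemma bij_shift_d:
  assumes "F \<in> flows r"
  shows "bij_betw (shift F \<circ> d) {1..N} (gadget_vertices n E M)"
  using bij_betw_trans[OF d bij_shift] assms by (auto simp: flows_def)

text \<open>Each flow sends \<open>a\<close> to exactly one \<open>b\<close>, so it is counted once
  on the left if it realizes \<open>I\<close>.\<close>

lemma sum_freq_row: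
  assumes "a \<in> {1..N}"
  shows "(\<Sum>b=1..N. freq r (insert (a, b) I)) = freq r I"
proof -
  have "card {b\<in>{1..N}. shift F (d a) = d b} = 1" if "F \<in> flows r" for F
  proof -
    have "shift F (d a) \<in> d ` {1..N}"
      using bij_shift_d[OF that] d assms by (auto simp: bij_betw_def)
    then obtain b where b: "b \<in> {1..N}" "shift F (d a) = d b" by blast
    then have "{b\<in>{1..N}. shift F (d a) = d b} = {b}"
      using inj_on_eq_iff[OF bij_betw_imp_inj_on[OF d]] by auto
    then show ?thesis by simp
  qed
  then have "(\<Sum>b=1..N. card {F\<in>{F\<in>flows r. realized F I}. shift F (d a) = d b}) =
      1 * card {F\<in>flows r. realized F I}"
    using finite_flows by (intro sum_multicount) auto
  moreover have "{F\<in>{F\<in>flows r. realized F I}. shift F (d a) = d b} = {F\<in>flows r. realized F (insert (a, b) I)}" for b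
    unfolding realized_def by blast
  ultimately have "(\<Sum>b=1..N. card {F\<in>flows r. realized F (insert (a, b) I)}) = card {F\<in>flows r. realized F I}"
    by simp
  then show ?thesis
    unfolding freq_def by (simp flip: sum_divide_distrib of_nat_sum)
qed

lemma sum_freq_col:
  assumes "b \<in> {1..N}"
  shows "(\<Sum>a=1..N. freq r (insert (a, b) I)) = freq r I"
proof -
  have "card {a\<in>{1..N}. shift F (d a) = d b} = 1" if "F \<in> flows r" for F
  proof -
    note bij = bij_shift_d[OF that]
    have "d b \<in> (shift F \<circ> d) ` {1..N}"
      using bij d assms by (auto simp: bij_betw_def)
    then obtain a where a: "a \<in> {1..N}" "d b = (shift F \<circ> d) a" by blast
    then have "{a\<in>{1..N}. shift F (d a) = d b} = {a}"
      using inj_on_eq_iff[OF bij_betw_imp_inj_on[OF bij]] by auto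
    then show ?thesis by simp
  qed
  then have "(\<Sum>a=1..N. card {F\<in>{F\<in>flows r. realized F I}. shift F (d a) = d b}) =
      1 * card {F\<in>flows r. realized F I}"
    using finite_flows by (intro sum_multicount) auto
  moreover have "{F\<in>{F\<in>flows r. realized F I}. shift F (d a) = d b} = {F\<in>flows r. realized F (insert (a, b) I)}" for a
    unfolding realized_def by blast
  ultimately have "(\<Sum>a=1..N. card {F\<in>flows r. realized F (insert (a, b) I)}) = card {F\<in>flows r. realized F I}"
    by simp
  then show ?thesis
    unfolding freq_def by (simp flip: sum_divide_distrib of_nat_sum)
qed

section \<open>The Sherali-Adams conditions up to level \<open>k\<close>\<close>

context
  fixes k :: nat
  assumes k: "4 * Suc k \<le> n"
begin

text \<open>The bound on \<open>k\<close> leaves room for one base vertex per assignment in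
  \<open>I\<close> and one more for a new assignment.\<close>

lemma small_bases:
  assumes "finite I" "card I \<le> k"
  obtains r where "r \<in> comp (base x \<union> bases I)" "finite (base x \<union> bases I)" "4 * card (base x \<union> bases I) \<le> n"
proof -
  let ?W = "base x \<union> bases I"
  have "card ?W \<le> card (base x) + card (bases I)" by (rule card_Un_le)
  then have "card ?W \<le> Suc k" using card_base[of x] card_bases[OF assms(1)] assms(2) by linarith
  then have "4 * card ?W \<le> n" using k by (meson le_trans mult_le_mono2)
  moreover have "finite ?W" using assms(1) by (auto simp: bases_def)
  ultimately show ?thesis using comp[of ?W] that by (cases "comp ?W = {}") auto
qed

text \<open>Only the base of \<open>d a\<close> is added to \<open>bases I\<close>, whatever
  \<open>b\<close> is, so a single defect \<open>r\<close> evaluates all terms.\<close>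

lemma pseudo_row:
  assumes "I \<subseteq> entries N" "card I \<le> k" "a \<in> {1..N}"
  shows "(\<Sum>b=1..N. pseudo (insert (a, b) I)) = pseudo I"
proof -
  have "finite I" using assms(1) by (rule finite_subset) simp
  then obtain r where r: "r \<in> comp (base (d a) \<union> bases I)" "finite (base (d a) \<union> bases I)"
    "4 * card (base (d a) \<union> bases I) \<le> n" using small_bases[OF _ assms(2)] by blast
  have "(\<Sum>b=1..N. pseudo (insert (a, b) I)) = (\<Sum>b=1..N. freq r (insert (a, b) I))"
    using r by (intro sum.cong refl pseudo_eq_freq) (auto simp: bases_insert)
  also have "\<dots> = freq r I" by (rule sum_freq_row) (rule assms)
  also have "\<dots> = pseudo I" using r by (intro pseudo_eq_freq[symmetric]) auto
  finally show ?thesis .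
qed

lemma freq_eq_0_base:
  assumes "(a, b) \<in> I" "base (d a) \<noteq> base (d b)"
  shows "freq r I = 0"
proof -
  have "\<not> realized F I" for F
  proof
    assume "realized F I"
    then have "shift F (d a) = d b" using assms(1) by (auto simp: realized_def)
    then show False using assms(2) base_shift[of F "d a"] by simp
  qed
  then show ?thesis by (simp add: freq_def)
qed

text \<open>Here the added base varies with \<open>a\<close>. Shifts preserve bases, so terms with a
  base other than that of \<open>d b\<close> vanish, and one defect \<open>r\<close> suffices for
  the rest.\<close>

lemma pseudo_col:
  assumes "I \<subseteq> entries N" "card I \<le> k" "b \<in> {1..N}"
  shows "(\<Sum>a=1..N. pseudo (insert (a, b) I)) = pseudo I"
proof -
  have "finite I" using assms(1) by (rule finite_subset) simp
  then obtain r where r: "r \<in> comp (base (d b) \<union> bases I)" "finite (base (d b) \<union> bases I)"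
    "4 * card (base (d b) \<union> bases I) \<le> n" using small_bases[OF _ assms(2)] by blast
  have "pseudo (insert (a, b) I) = freq r (insert (a, b) I)" for a
  proof (cases "base (d a) = base (d b)")
    case True
    then show ?thesis using r by (intro pseudo_eq_freq) (auto simp: bases_insert)
  next
    case False
    then show ?thesis
      using freq_eq_0_base[of a b "insert (a, b) I"] by (simp add: pseudo_def)
  qed
  then have "(\<Sum>a=1..N. pseudo (insert (a, b) I)) = (\<Sum>a=1..N. freq r (insert (a, b) I))" by simp
  also have "\<dots> = freq r I" by (rule sum_freq_col) (rule assms)
  also have "\<dots> = pseudo I" using r by (intro pseudo_eq_freq[symmetric]) auto
  finally show ?thesis .
qed

abbreviation "G \<equiv> pullback_edges N d (gadget_adj E (\<lambda>_. False))"
abbreviation "H \<equiv> pullback_edges N d (gadget_adj E (\<lambda>v. v = z))"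

text \<open>With the defect outside \<open>bases I\<close>, every flow preserves adjacency between
  the vertices that \<open>I\<close> assigns, so none realizes an \<open>I\<close> that violates
  it.\<close>

lemma pseudo_partial_iso:
  assumes "I \<subseteq> entries N" "card I \<le> Suc k" "(a1, b1) \<in> I" "(a2, b2) \<in> I"
    "{a1, a2} \<in> G \<longleftrightarrow> {b1, b2} \<notin> H"
  shows "pseudo I = 0"
proof -
  have "finite I" using assms(1) by (rule finite_subset) simp
  have B: "finite (bases I)" "4 * card (bases I) \<le> n"
    using \<open>finite I\<close> card_bases[OF \<open>finite I\<close>] assms(2) k by (auto simp: bases_def)
  then obtain r where r: "r \<in> comp (bases I)" using comp[OF B] by (cases "comp (bases I) = {}") auto
  have ab: "a1 \<in> {1..N}" "a2 \<in> {1..N}" "b1 \<in> {1..N}" "b2 \<in> {1..N}" using assms by auto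
  have "\<not> realized F I" if "F \<in> flows r" for F
  proof
    assume "realized F I"
    then have s: "shift F (d a1) = d b1" "shift F (d a2) = d b2"
      using assms(3,4) by (auto simp: realized_def)
    have "r \<notin> bases I" using comp[OF B] r by blast
    then have "r \<notin> base (d a1)" "r \<notin> base (d a2)" using assms(3,4) by (auto simp: bases_def)
    moreover have "d a1 \<in> gadget_vertices n E M" "d a2 \<in> gadget_vertices n E M"
      using d ab by (auto simp: bij_betw_def)
    ultimately have "gadget_adj E (\<lambda>v. v = z) (d b1) (d b2) \<longleftrightarrow> gadget_adj E (\<lambda>_. False) (d a1) (d a2)"
      using that finite_E unfolding s[symmetric] flows_def by (intro gadget_adj_shift) auto
    then show False
      using assms(5) ab by (simp add: pullback_edges_iff gadget_adj_sym del: atLeastAtMost_iff)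
  qed
  then have "{F\<in>flows r. realized F I} = {}" by blast
  then have "freq r I = 0" by (simp only: freq_def card.empty of_nat_0 div_0)
  then show ?thesis using pseudo_eq_freq[OF subset_refl B r] by simp
qed

lemma SA_gadget_pair_nonempty:
  assumes "k \<ge> 1"
  shows "\<T>_SA N G H k \<noteq> {}" "\<Q>_SA N G H k \<noteq> {}"
  by (rule SA_nonempty[where y = pseudo];
      (rule pseudo_empty pseudo_nonneg pseudo_row pseudo_col pseudo_partial_iso assms; assumption)?)+

end
end

text \<open>Gadgets have at most \<open>2 ^ D\<close> vertices each, and the markers number
  \<open>n + 2\<close> more than all gadget vertices. For positive \<open>n\<close> this gives the
  factor \<open>2 * 2 ^ D + 3\<close>.\<close>

lemma gadget_pair_exists:
  assumes E: "\<And>e. e \<in> E \<Longrightarrow> e \<subseteq> {..<n} \<and> card e = 2" and deg: "\<And>v. v < n \<Longrightarrow> card (incident E v) \<le> D"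
    and mixing: "mixing {..<n} E"
    and n: "n > 0"
  shows "\<exists>N G H. simple_graph N G \<and> simple_graph N H \<and> \<not> isomorphic N G H \<and>
    N \<le> (2 * 2 ^ D + 3) * n \<and>
    (\<forall>k\<ge>1. 4 * Suc k \<le> n \<longrightarrow> \<T>_SA N G H k \<noteq> {} \<and> \<Q>_SA N G H k \<noteq> {})"
proof -
  let ?R = "SIGMA v:{..<n}. Pow (incident E v)"
  define M where "M = card ?R + n + 2"
  let ?V = "gadget_vertices n E M"
  have "E \<subseteq> Pow {..<n}" using E by auto
  then have finE: "finite E" by (rule finite_subset) simp
  have finR: "finite ?R" using finE by auto
  have "finite ?V" using finR by (simp add: gadget_vertices_def)
  then obtain d where d: "bij_betw d {1..card ?V} ?V" using ex_bij_betw_nat_finite_1 by blast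
  have "\<exists>S. finite W \<longrightarrow> 4 * card W \<le> n \<longrightarrow> S \<subseteq> {..<n} - W \<and> n < 2 * card S \<and>
      (\<forall>r\<in>S. \<forall>s\<in>S. joined_outside E W r s)" for W
    using giant_component[of "{..<n}" E W] n finE E mixing by auto
  then obtain comp where comp: "\<And>W. finite W \<Longrightarrow> 4 * card W \<le> n \<Longrightarrow>
      comp W \<subseteq> {..<n} - W \<and> n < 2 * card (comp W) \<and>
      (\<forall>r\<in>comp W. \<forall>s\<in>comp W. joined_outside E W r s)" by metis
  have "comp {} \<noteq> {}" "comp {} \<subseteq> {..<n}" using comp[of "{}"] by auto
  then obtain z where z_comp: "z \<in> comp {}" and z_less: "z < n" by auto
  interpret gadget_pair n E M z "card ?V" d comp
    by standard (use finE d comp z_comp in auto)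
  have irrefl: "\<not> gadget_adj E c x x" for c x
  proof -
    have "{v} \<notin> E" for v using E[of "{v}"] by auto
    then show ?thesis by (cases x) auto
  qed
  have "\<not> isomorphic (card ?V) G H"
  proof
    assume "isomorphic (card ?V) G H"
    from isomorphic_pullbackD[OF d gadget_adj_sym gadget_adj_sym this]
    obtain f where "bij_betw f ?V ?V"
      "\<forall>x\<in>?V. \<forall>y\<in>?V. gadget_adj E (\<lambda>_. False) x y \<longleftrightarrow> gadget_adj E (\<lambda>v. v = z) (f x) (f y)" by blast
    then show False using E finE z_less by (intro no_gadget_isomorphism[of E n M z f]) (auto simp: M_def)
  qed
  moreover have "card ?V \<le> (2 * 2 ^ D + 3) * n"
  proof -
    have "card ?R = (\<Sum>v<n. card (Pow (incident E v)))" using finE by (subst card_SigmaI) auto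
    also have "\<dots> \<le> (\<Sum>v<n. 2 ^ D)"
      using finE deg by (intro sum_mono) (simp add: card_Pow)
    finally have R: "card ?R \<le> n * 2 ^ D" by simp
    have "card ?V \<le> card (Inl ` ?R :: gadget_vertex set) + card (Inr ` {..<M} :: gadget_vertex set)"
      unfolding gadget_vertices_def by (rule card_Un_le)
    also have "\<dots> = card ?R + M" by (simp add: card_image)
    finally have "card ?V \<le> 2 * (n * 2 ^ D) + n + 2" using R by (simp add: M_def)
    also have "\<dots> \<le> (2 * 2 ^ D + 3) * n" using n by (simp add: algebra_simps)
    finally show ?thesis .
  qed
  moreover have "simple_graph (card ?V) G" "simple_graph (card ?V) H"
    using irrefl by (intro simple_graph_pullback; simp)+
  moreover have "\<forall>k\<ge>1. 4 * Suc k \<le> n \<longrightarrow> \<T>_SA (card ?V) G H k \<noteq> {} \<and> \<Q>_SA (card ?V) G H k \<noteq> {}"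
    using SA_gadget_pair_nonempty by auto
  ultimately show ?thesis by (intro exI[of _ "card ?V"] exI[of _ G] exI[of _ H] conjI)
qed

theorem corollary1p4:
  shows "\<exists>(c::real) (C::real) (n0::nat) (N::nat \<Rightarrow> nat)
      (G::nat \<Rightarrow> nat set set) (H::nat \<Rightarrow> nat set set).
    c > 0 \<and> C > 0 \<and>
    (\<forall>n\<ge>n0.
       simple_graph (N n) (G n) \<and> simple_graph (N n) (H n) \<and>
       \<not> isomorphic (N n) (G n) (H n) \<and>
       real (N n) \<le> C * real n \<and>
       conv (iso_matrices (N n) (G n) (H n)) = {} \<and>
       (\<forall>k\<ge>1. \<T>_SA (N n) (G n) (H n) k = {} \<longrightarrow> real k \<ge> c * real n) \<and>
       (\<forall>k\<ge>1. \<Q>_SA (N n) (G n) (H n) k = {} \<longrightarrow> real k \<ge> c * real n))"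
proof -
  from bounded_degree_mixing_graph
  obtain D :: nat where D: "\<forall>V :: nat set. finite V \<and> V \<noteq> {} \<longrightarrow>
    (\<exists>E. (\<forall>e\<in>E. e \<subseteq> V \<and> card e = 2) \<and> (\<forall>v\<in>V. card {e\<in>E. v \<in> e} \<le> D) \<and> mixing V E)" ..
  have "\<exists>N G H. simple_graph N G \<and> simple_graph N H \<and> \<not> isomorphic N G H \<and>
    N \<le> (2 * 2 ^ D + 3) * n \<and>
    (\<forall>k\<ge>1. 4 * Suc k \<le> n \<longrightarrow> \<T>_SA N G H k \<noteq> {} \<and> \<Q>_SA N G H k \<noteq> {})" if "n \<ge> 8" for n
  proof -
    have "finite {..<n} \<and> {..<n} \<noteq> {}" using that by (auto simp: lessThan_empty_iff)
    from D[rule_format, OF this] obtain E where "\<forall>e\<in>E. e \<subseteq> {..<n} \<and> card e = 2" "\<forall>v\<in>{..<n}. card {e\<in>E. v \<in> e} \<le> D"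
      "mixing {..<n} E" by blast
    then show ?thesis
      using that by (intro gadget_pair_exists[of E]) auto
  qed
  then obtain N G H where NGH: "\<And>n. n \<ge> 8 \<Longrightarrow> simple_graph (N n) (G n) \<and> simple_graph (N n) (H n) \<and>
    \<not> isomorphic (N n) (G n) (H n) \<and> N n \<le> (2 * 2 ^ D + 3) * n \<and>
    (\<forall>k\<ge>1. 4 * Suc k \<le> n \<longrightarrow> \<T>_SA (N n) (G n) (H n) k \<noteq> {} \<and> \<Q>_SA (N n) (G n) (H n) k \<noteq> {})"
    by metis
  \<comment> \<open>Over an empty set of matrices the weights sum to 0 instead of 1.\<close>
  have "conv (iso_matrices (N n) (G n) (H n)) = {}" if "n \<ge> 8" for n
    using NGH[OF that] by (auto simp: conv_def iso_matrices_def isomorphic_def)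
  moreover have "real (N n) \<le> (2 * 2 ^ D + 3) * real n" if "n \<ge> 8" for n
  proof -
    have "real (N n) \<le> real ((2 * 2 ^ D + 3) * n)" using NGH[OF that] by (simp only: of_nat_le_iff)
    then show ?thesis by simp
  qed
  \<comment> \<open>From \<open>4 * (k + 1) > n\<close> follows \<open>k > n / 4 - 1\<close>, and
    this is at least \<open>n / 8\<close> once \<open>n \<ge> 8\<close>; hence the threshold and the
    constant.\<close>
  moreover have "1 / 8 * real n \<le> real k" if "n \<ge> 8" "\<not> 4 * Suc k \<le> n" for n k :: nat
  proof -
    have "real n < real (4 * k + 4)" using that(2) by (simp only: of_nat_less_iff) simp
    then show ?thesis using that(1) by simp
  qed
  ultimately have "\<forall>n\<ge>8. simple_graph (N n) (G n) \<and> simple_graph (N n) (H n) \<and>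
      \<not> isomorphic (N n) (G n) (H n) \<and> real (N n) \<le> (2 * 2 ^ D + 3) * real n \<and>
      conv (iso_matrices (N n) (G n) (H n)) = {} \<and>
      (\<forall>k\<ge>1. \<T>_SA (N n) (G n) (H n) k = {} \<longrightarrow> real k \<ge> 1 / 8 * real n) \<and>
      (\<forall>k\<ge>1. \<Q>_SA (N n) (G n) (H n) k = {} \<longrightarrow> real k \<ge> 1 / 8 * real n)"
    using NGH by blast
  moreover have "(1::real) / 8 > 0" "(2::real) * 2 ^ D + 3 > 0" by (auto intro: add_pos_pos)
  ultimately show ?thesis by (intro exI conjI)
qed

end
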